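(* Let $\mu\ne\delta_0$ be a Borel probability measure on $[0,+\infty)$, and let $t\ge1$ be a real number. (1) There exists a probability measure $\mu_t\neq\delta_0$ on $[0,+\infty)$ such that $\Sigma_{\mu_t}(z)=\Sigma_\mu(z)^t$ for $z<0$ sufficiently close to zero. (2) There exists an analytic function $\omega_t:\mathbb C\setminus[0,+\infty)\to\mathbb C\setminus[0,+\infty)$ such that $\omega_t((-\infty,0))\subset(-\infty,0)$, $\omega_t(0-)=0$, $\arg\omega_t(z)\in[\arg z,\pi)$ for all $z\in\mathbb C^+$, and $\eta_{\mu_t}(z)=\eta_\mu(\omega_t(z))$ for all $z\in\mathbb C\setminus[0,+\infty)$. (3) The function $\omega_t$ is given by $$\omega_t(z)=\eta_{\mu_t}(z)\left[\frac z{\eta_{\mu_t}(z)}\right]^{1/t},\quad z\in\mathbb C\setminus[0,+\infty),$$ where the power is taken to be positive for $z<0$. (4) The analytic function $\Phi_t:\mathbb C\setminus[0,+\infty)\to\mathbb C\setminus\{0\}$ defined by $$\Phi_t(z)=z\left[\frac z{\eta_\mu(z)}\right]^{t-1},\quad z\in\mathbb C\setminus[0,+\infty),$$ satisfies $\Phi_t(\omega_t(z))=z$ for $z\in\mathbb C\setminus[0,+\infty)$.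
   Context: $\mathbb C^+=\{\Im z>0\}$ and $\arg$ takes values in $(0,\pi)$ on $\mathbb C^+$. For a Borel probability measure $\mu$ on $[0,+\infty)$ set $\psi_\mu(z)=\int_{[0,+\infty)}\frac{zt}{1-zt}\,d\mu(t)$ and $\eta_\mu=\psi_\mu/(1+\psi_\mu)$ on $\mathbb C\setminus[0,+\infty)$. If $\mu\neq\delta_0$, $\eta_\mu$ is injective on $(-\infty,0)$, maps it into $(-\infty,0)$, and $\lim_{x\uparrow0}\eta_\mu(x)=0$; $\eta_\mu^{-1}$ is the inverse of $\eta_\mu|_{(-\infty,0)}$ (extended analytically to a neighborhood of $\eta_\mu((-\infty,0))$) and $\Sigma_\mu(z)=\eta_\mu^{-1}(z)/z$. Notation: $\omega(0-)=\lim_{x\to0,\,x<0}\omega(x)$. All powers denote the analytic branches that are positive for $z<0$. The same $\mu_t$ and $\omega_t$ appear in (1)-(4). *)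

theory Defs
  imports "HOL-Probability.Probability" "HOL-Complex_Analysis.Complex_Analysis"
begin

(* A Borel probability measure on the half-line is carried as a Borel probability
   measure on the real line which does not charge the negative numbers. *)
definition prob_on_nonneg :: "real measure \<Rightarrow> bool" where
  "prob_on_nonneg \<mu> \<longleftrightarrow> real_distribution \<mu> \<and> emeasure \<mu> {..<0} = 0"

abbreviation delta0 :: "real measure" where
  "delta0 \<equiv> return borel 0"

abbreviation slit :: "complex set" where
  "slit \<equiv> - \<real>\<^sub>\<ge>\<^sub>0"

abbreviation neg_axis :: "complex set" where
  "neg_axis \<equiv> complex_of_real ` {..<0}"

definition psi :: "real measure \<Rightarrow> complex \<Rightarrow> complex" where
  "psi \<mu> z = (LINT t:{0..}|\<mu>. z * of_real t / (1 - z * of_real t))"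

definition eta :: "real measure \<Rightarrow> complex \<Rightarrow> complex" where
  "eta \<mu> z = psi \<mu> z / (1 + psi \<mu> z)"

(* Only meaningful on eta \<mu> ` neg_axis, which contains a left neighbourhood of 0
   in the real line when \<mu> \<noteq> delta0; the analytic continuation of the inverse off
   the real line is not modelled. *)
definition eta_inv :: "real measure \<Rightarrow> complex \<Rightarrow> complex" where
  "eta_inv \<mu> = inv_into neg_axis (eta \<mu>)"

definition Sigma_transform :: "real measure \<Rightarrow> complex \<Rightarrow> complex" where
  "Sigma_transform \<mu> z = eta_inv \<mu> z / z"

(* g is the analytic branch of f^s on the slit plane that is positive on the negative
   half-line; L is an analytic logarithm of f.  Two such L differ by a constant in
   2 pi i Z, as the slit plane is connected, and positivity then makes g unique on
   the slit plane. *)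
definition is_power_branch ::
    "(complex \<Rightarrow> complex) \<Rightarrow> real \<Rightarrow> (complex \<Rightarrow> complex) \<Rightarrow> bool" where
  "is_power_branch f s g \<longleftrightarrow>
     (\<exists>L. L holomorphic_on slit \<and>
          (\<forall>z\<in>slit. f z = exp (L z) \<and> g z = exp (of_real s * L z))) \<and>
     (\<forall>x<0. g (complex_of_real x) \<in> \<real> \<and> Re (g (complex_of_real x)) > 0)"

end

theory Submission
  imports Defs "HOL-Real_Asymp.Real_Asymp"
begin

text \<open>
  In the coordinate \<open>z = e\<^sup>u\<close> the slit plane becomes the strip \<open>0 < Im u < 2\<pi>\<close>, and
  \<open>\<eta>\<^sub>\<mu>\<close> becomes a self-map \<open>L\<close> of that strip. Inverting \<open>\<Phi>\<^sub>t\<close> amounts to solving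
  \<open>t u - (t - 1) L u = \<zeta>\<close>, that is, to finding the fixed points of the convex combination
  \<open>(\<zeta> + (t - 1) L u) / t\<close>. It maps the strip into a narrower one and, since \<open>L\<close> has at most
  linear growth with slope one, it preserves a large rectangle: Brouwer's theorem yields a fixed
  point and the Schwarz lemma its uniqueness.

  For \<open>Im z > 0\<close> one has \<open>arg z \<le> arg \<eta>\<^sub>\<mu>(z) < \<pi>\<close>, by Cauchy-Schwarz, and
  \<open>\<eta>\<^sub>\<mu> \<circ> \<omega>\<^sub>t\<close> inherits this. Such a function is of the form \<open>\<eta>\<^sub>\<nu>\<close>: with
  \<open>k = 1 / (1 - \<eta>\<^sub>\<mu> \<circ> \<omega>\<^sub>t)\<close>, the function \<open>y k(-y\<^sup>2)\<close> has nonnegative real part on the right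
  half-plane, and its Herglotz measure, transported from the circle to \<open>[0,\<infinity>)\<close>, is \<open>\<nu>\<close> up to a
  density.
\<close>

text \<open>One equation carries all four claims. With \<open>u\<close> a logarithm of omega_t(z)
  and \<open>zeta\<close> one of z, \<open>t u - (t - 1) L u = zeta\<close> is (4) in logarithmic
  form; rewritten as \<open>u = L u + (zeta - L u) / t\<close> it is (3); read on the midline
  \<open>Im u = pi\<close>, the image of the negative axis, it is the identity in (1). Every power
  is the exponential of a multiple of a logarithm, so no branch has to be followed. The estimate arg
  z <= arg eta(z) says that L moves points towards the midline; hence solutions stay on their side
  of it, which yields both the bounds on arg omega_t and the positivity behind the Herglotz measure.
  The obstacles are two losses of compactness: the strip is unbounded, so the fixed point argument
  requires control of \<open>Re (L u)\<close>, and the Herglotz measure could have mass at s =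
  infinity, which the limit of k at 0- excludes.\<close>

section \<open>The slit plane in logarithmic coordinates\<close>

text \<open>The logarithm with argument in (0, 2 pi). It sends the negative axis to the midline Im =
  pi of the strip, where conjugation becomes a reflection.\<close>

definition slog :: "complex \<Rightarrow> complex" where
  "slog z = Ln (- z) + \<i> * of_real pi"

definition strip :: "complex set" where
  "strip = {u. 0 < Im u \<and> Im u < 2 * pi}"

lemma open_strip: "open strip"
  unfolding strip_def by (intro open_Collect_conj open_halfspace_Im_gt open_halfspace_Im_lt)

lemma convex_strip: "convex strip"
  unfolding strip_def Collect_conj_eq
  by (intro convex_Int convex_halfspace_Im_gt convex_halfspace_Im_lt)

lemma slit_iff: "z \<in> slit \<longleftrightarrow> Im z \<noteq> 0 \<or> Re z < 0"
  by (auto simp: complex_nonneg_Reals_iff)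

lemma cnj_slit: "z \<in> slit \<Longrightarrow> cnj z \<in> slit"
  by (simp add: complex_nonneg_Reals_iff)

lemma open_slit: "open slit"
  by (simp add: open_Compl)

lemma neg_in_slit: "x < 0 \<Longrightarrow> complex_of_real x \<in> slit"
  by (simp add: slit_iff)

lemma exp_slog: "z \<in> slit \<Longrightarrow> exp (slog z) = z"
  by (cases "z = 0") (auto simp: slog_def exp_add exp_pi_i')

lemma slog_in_strip:
  assumes "z \<in> slit" shows "slog z \<in> strip"
proof -
  have "- z \<notin> \<real>\<^sub>\<le>\<^sub>0"
    using assms by (auto simp: complex_nonneg_Reals_iff complex_nonpos_Reals_iff)
  moreover have "z \<noteq> 0"
    using assms by auto
  ultimately show ?thesis
    using Im_Ln_less_pi[of "-z"] mpi_less_Im_Ln[of "-z"]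
    by (auto simp: strip_def slog_def)
qed

lemma holomorphic_slog: "slog holomorphic_on slit"
  unfolding slog_def
  by (intro holomorphic_intros) (auto simp: complex_nonneg_Reals_iff complex_nonpos_Reals_iff)

lemma slog_exp:
  assumes "u \<in> strip" shows "slog (exp u) = u"
proof -
  have "Ln (exp (u - \<i> * of_real pi)) = u - \<i> * of_real pi"
    using assms by (intro Ln_exp) (auto simp: strip_def)
  moreover have "exp (u - \<i> * of_real pi) = - exp u"
    by (simp add: exp_diff exp_pi_i')
  ultimately show ?thesis by (simp add: slog_def)
qed

lemma exp_in_slit:
  assumes "u \<in> strip" shows "exp u \<in> slit"
proof (rule ccontr)
  assume "exp u \<notin> slit"
  then have "Im (exp u) = 0" "Re (exp u) \<ge> 0"
    by (auto simp: complex_nonneg_Reals_iff)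
  then have s: "sin (Im u) = 0" and c: "cos (Im u) \<ge> 0"
    by (auto simp: Im_exp Re_exp zero_le_mult_iff)
  have "sin (Im u - pi) = 0" using s by simp
  moreover have "- pi < Im u - pi" "Im u - pi < pi"
    using assms by (auto simp: strip_def)
  ultimately have "Im u = pi"
    using sin_eq_0_pi by fastforce
  then show False using c by simp
qed

lemma connected_slit: "connected slit"
proof -
  have "slit = exp ` strip"
    using exp_in_slit exp_slog slog_in_strip by (metis (no_types, lifting) image_iff subsetI subset_antisym)
  then show ?thesis
    using connected_continuous_image[OF continuous_on_exp[OF continuous_on_id]
        convex_connected[OF convex_strip]] by simp
qed

lemma slog_neg: "x < 0 \<Longrightarrow> slog (of_real x) = of_real (ln (- x)) + \<i> * of_real pi"
  by (simp add: slog_def flip: of_real_minus Ln_of_real)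

lemma exp_midline: "exp (of_real a + \<i> * of_real pi) = of_real (- exp a)"
  by (simp add: exp_add exp_pi_i' flip: exp_of_real)

lemma slog_cnj:
  assumes "z \<in> slit" shows "slog (cnj z) = cnj (slog z) + 2 * \<i> * of_real pi"
proof -
  have "- z \<notin> \<real>\<^sub>\<le>\<^sub>0"
    using assms by (auto simp: complex_nonneg_Reals_iff complex_nonpos_Reals_iff)
  then have "Ln (cnj (- z)) = cnj (Ln (- z))"
    by (rule cnj_Ln[symmetric])
  then show ?thesis by (simp add: slog_def)
qed

lemma Arg_eq_Im_slog:
  assumes "Im z > 0" shows "Arg z = Im (slog z)"
proof -
  have "z \<noteq> 0" using assms by auto
  then show ?thesis using assms by (simp add: slog_def Ln_minus Arg_def)
qed

section \<open>Holomorphic self-maps of the strip\<close>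

text \<open>The Moebius map in \<open>g\<close> takes the right half-plane to the disc and
  \<open>f 0\<close> to 0, so the Schwarz lemma gives |g w| <= |w|; solving for \<open>f w\<close>
  gives the Harnack-type bound.\<close>

lemma Schwarz_right_half_plane:
  assumes "f holomorphic_on ball 0 1" and pos: "\<And>w. cmod w < 1 \<Longrightarrow> Re (f w) > 0"
    and w: "cmod w < 1"
  shows "cmod (f w) \<le> cmod (f 0) * ((1 + cmod w) / (1 - cmod w))"
proof -
  define a where "a = f 0"
  define g where "g = (\<lambda>w. (f w - a) / (f w + cnj a))"
  have a: "Re a > 0" using pos[of 0] by (simp add: a_def)
  have nz: "f w + cnj a \<noteq> 0" if "cmod w < 1" for w
    using pos[OF that] a by (auto simp: complex_eq_iff)
  have lt: "cmod (g w) < 1" if "cmod w < 1" for w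
  proof -
    have "(cmod (f w - a))\<^sup>2 < (cmod (f w + cnj a))\<^sup>2"
      using mult_pos_pos[OF pos[OF that] a]
      unfolding cmod_power2 by (simp add: power2_eq_square algebra_simps)
    then have "cmod (f w - a) < cmod (f w + cnj a)"
      by (rule power_less_imp_less_base) simp
    then show ?thesis using nz[OF that] by (simp add: g_def norm_divide divide_simps)
  qed
  have "g holomorphic_on ball 0 1"
    unfolding g_def using assms(1) nz by (intro holomorphic_intros) auto
  then have le: "cmod (g w) \<le> cmod w"
    by (rule Schwarz_Lemma(1)) (use w lt in \<open>auto simp: g_def a_def\<close>)
  have eq: "f w * (1 - g w) = a + cnj a * g w"
    using nz[OF w] by (simp add: g_def field_simps)
  have "cmod (f w) * (1 - cmod w) \<le> cmod (f w) * cmod (1 - g w)"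
    using le norm_triangle_ineq2[of 1 "g w"] by (intro mult_left_mono) auto
  also have "\<dots> = cmod (a + cnj a * g w)" by (simp flip: norm_mult add: eq)
  also have "\<dots> \<le> cmod a + cmod a * cmod w"
    by (rule order.trans[OF norm_triangle_ineq]) (use le in \<open>auto simp: norm_mult intro: mult_left_mono\<close>)
  finally show ?thesis using w by (simp add: a_def field_simps)
qed

lemma Cayley_transform_Re_pos:
  assumes "cmod w < 1"
  shows "1 + w \<noteq> 0" "0 < Re ((1 - w) / (1 + w))"
proof -
  show np: "1 + w \<noteq> 0"
    using assms by (metis add_eq_0_iff2 norm_minus_cancel norm_one order_less_irrefl)
  have "1 - (Re w)\<^sup>2 - (Im w)\<^sup>2 > 0"
    using assms power_strict_mono[of "cmod w" 1 2] by (simp add: cmod_power2)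
  moreover have "(Re (1 + w))\<^sup>2 + (Im (1 + w))\<^sup>2 > 0"
    using np unfolding sum_power2_gt_zero_iff complex_eq_iff by simp
  moreover have "Re (1 - w) * Re (1 + w) + Im (1 - w) * Im (1 + w) = 1 - (Re w)\<^sup>2 - (Im w)\<^sup>2"
    by (simp add: power2_eq_square algebra_simps)
  ultimately show "0 < Re ((1 - w) / (1 + w))"
    unfolding Re_divide by simp
qed

text \<open>Slope one is what makes the rectangle of the fixed point argument invariant. It is Harnack's
  inequality for \<open>exp ((L - \<i>\<pi>) / 2)\<close> and its inverse, both of positive real part.\<close>

lemma strip_self_map_linear_growth:
  assumes hol: "L holomorphic_on strip" and im: "L ` strip \<subseteq> strip" and "0 < e" "e \<le> pi"
  shows "\<exists>C. \<forall>u. e \<le> Im u \<and> Im u \<le> 2 * pi - e \<longrightarrow> \<bar>Re (L u)\<bar> \<le> \<bar>Re u\<bar> + C"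
proof -
  \<comment> \<open>\<open>U\<close> is the conformal map of the unit disc onto the strip. Its
    factor 2 is undone by the half in \<open>f\<close>, and this is where the slope one comes
    from.\<close>
  define U where "U = (\<lambda>w::complex. 2 * Ln ((1 - w) / (1 + w)) + \<i> * of_real pi)"
  define f where "f = (\<lambda>w. exp ((L (U w) - \<i> * of_real pi) / 2))"
  have np: "1 + w \<noteq> 0" and Repos: "0 < Re ((1 - w) / (1 + w))" if "cmod w < 1" for w
    using Cayley_transform_Re_pos[OF that] by auto
  have Uin: "U w \<in> strip" if "cmod w < 1" for w
    using Re_Ln_pos_lt_imp[OF Repos[OF that]] np[OF that] Repos[OF that]
    by (auto simp: U_def strip_def)
  have Uhol: "U holomorphic_on ball 0 1"
    unfolding U_def using Repos np
    by (intro holomorphic_intros) (auto simp: complex_nonpos_Reals_iff, smt (verit))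
  have "(L \<circ> U) holomorphic_on ball 0 1"
    by (rule holomorphic_on_compose_gen[OF Uhol hol]) (use Uin in auto)
  then have LU: "(\<lambda>w. L (U w)) holomorphic_on ball 0 1" by (simp add: o_def)
  then have fhol: "f holomorphic_on ball 0 1" "(\<lambda>w. inverse (f w)) holomorphic_on ball 0 1"
    unfolding f_def by (intro holomorphic_intros; simp)+
  have fpos: "Re (f w) > 0" if "cmod w < 1" for w
  proof -
    have "L (U w) \<in> strip" using Uin[OF that] im by auto
    then have "cos ((Im (L (U w)) - pi) / 2) > 0"
      by (intro cos_gt_zero_pi) (auto simp: strip_def)
    then show ?thesis by (simp add: f_def Re_exp)
  qed
  then have fpos': "Re (inverse (f w)) > 0" if "cmod w < 1" for w
    using fpos[OF that] by (auto simp: sum_power2_gt_zero_iff)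
  \<comment> \<open>The minimum of cos((Im u - pi) / 2) over the band e <= Im u <= 2 pi - e.\<close>
  define d where "d = sin (e / 2)"
  have d: "d > 0" unfolding d_def using assms by (intro sin_gt_zero) auto
  \<comment> \<open>Bounding both \<open>f\<close> and \<open>inverse f\<close> bounds
    \<open>Re (L u)\<close> from above and from below.\<close>
  define K where "K = max (cmod (f 0)) (cmod (inverse (f 0)))"
  have K: "K > 0" using fpos[of 0] by (auto simp: K_def less_max_iff_disj)
  have "\<bar>Re (L u)\<bar> \<le> \<bar>Re u\<bar> + 2 * ln (4 * K / d)" if u: "e \<le> Im u" "Im u \<le> 2 * pi - e" for u
  proof -
    define E where "E = exp ((u - \<i> * of_real pi) / 2)"
    define r where "r = cmod E"
    have r: "r = exp (Re u / 2)" "r > 0" by (auto simp: r_def E_def)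
    have "cos ((Im u - pi) / 2) \<ge> d"
    proof -
      have "\<bar>(Im u - pi) / 2\<bar> \<le> pi/2 - e/2" using u by (auto simp: abs_le_iff field_simps)
      then have "cos (pi/2 - e/2) \<le> cos \<bar>(Im u - pi) / 2\<bar>"
        using assms by (intro cos_monotone_0_pi_le) auto
      then show ?thesis unfolding cos_abs_real by (simp add: d_def cos_diff)
    qed
    then have ReE: "Re E \<ge> d * r" using r by (simp add: E_def Re_exp r(1) mult.commute)
    then have ReE0: "Re E > 0" using d r(2) by (smt (verit) mult_pos_pos)
    then have E1: "1 + E \<noteq> 0" by (auto simp: complex_eq_iff)
    define w where "w = (1 - E) / (1 + E)"
    have wE: "(1 - w) / (1 + w) = E"
      using E1 by (simp add: w_def divide_simps)
    \<comment> \<open>This turns the disc quantity (1 + |w|) / (1 - |w|) into one of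
      \<open>E\<close>, and hence of \<open>Re u\<close>: inside the band it is at most a constant
      times exp |Re u / 2|.\<close>
    have id: "1 - (cmod w)\<^sup>2 = 4 * Re E / (cmod (1 + E))\<^sup>2"
    proof -
      have "(cmod (1 + E))\<^sup>2 - (cmod (1 - E))\<^sup>2 = 4 * Re E"
        unfolding cmod_power2 by (simp add: power2_eq_square algebra_simps)
      moreover have "1 - (cmod w)\<^sup>2 = ((cmod (1 + E))\<^sup>2 - (cmod (1 - E))\<^sup>2) / (cmod (1 + E))\<^sup>2"
        unfolding w_def norm_divide power_divide using E1 by (simp add: diff_divide_distrib)
      ultimately show ?thesis by simp
    qed
    have w1: "cmod w < 1"
    proof -
      have "1 - (cmod w)\<^sup>2 > 0" unfolding id using ReE0 E1 by simp
      then show ?thesis by (simp add: power_less_one_iff abs_square_less_1)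
    qed
    have Uw: "U w = u"
    proof -
      define v where "v = u - \<i> * of_real pi"
      have *: "Ln (exp (v / 2)) = v / 2"
        by (intro Ln_exp) (use u assms in \<open>auto simp: v_def\<close>)
      have "2 * Ln (exp (v / 2)) = v" unfolding * by simp
      then show ?thesis by (simp only: U_def wE E_def flip: v_def) (simp add: v_def)
    qed
    have "(1 + cmod w) / (1 - cmod w) = ((1 + cmod w) * (1 + cmod w)) / ((1 + cmod w) * (1 - cmod w))"
      using norm_ge_zero[of w] by (subst mult_divide_mult_cancel_left) linarith+
    also have "\<dots> = (1 + cmod w)\<^sup>2 / (1 - (cmod w)\<^sup>2)"
      by (simp add: power2_eq_square algebra_simps)
    also have "\<dots> \<le> 4 / (1 - (cmod w)\<^sup>2)"
      using w1 power_mono[of "1 + cmod w" 2 2]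
      by (intro divide_right_mono) (auto simp: power_le_one)
    also have "\<dots> = (cmod (1 + E))\<^sup>2 / Re E" unfolding id by simp
    also have "\<dots> \<le> (1 + r)\<^sup>2 / (d * r)"
      using ReE ReE0 d r(2) norm_triangle_ineq[of 1 E]
      by (intro frac_le power_mono) (auto simp: r_def)
    also have "\<dots> \<le> 4 * exp \<bar>Re u / 2\<bar> / d"
    proof -
      have "(1 + r)\<^sup>2 \<le> 4 * exp \<bar>Re u / 2\<bar> * r"
      proof (cases "Re u \<ge> 0")
        case True
        then have "r \<ge> 1" "exp \<bar>Re u / 2\<bar> = r" by (auto simp: r)
        then show ?thesis using power_mono[of "1 + r" "2 * r" 2] by (simp add: power2_eq_square)
      next
        case False
        then have "r \<le> 1" "exp \<bar>Re u / 2\<bar> * r = 1" by (auto simp: r simp flip: exp_add)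
        then show ?thesis using power_mono[of "1 + r" "2" 2] r(2) by simp
      qed
      then show ?thesis using d r(2) by (simp add: field_simps)
    qed
    finally have H: "(1 + cmod w) / (1 - cmod w) \<le> 4 * exp \<bar>Re u / 2\<bar> / d" .
    have bd: "X \<le> 4 * K / d * exp \<bar>Re u / 2\<bar>"
      if "X \<le> Y * ((1 + cmod w) / (1 - cmod w))" "Y \<le> K" for X Y
    proof -
      have "Y * ((1 + cmod w) / (1 - cmod w)) \<le> K * (4 * exp \<bar>Re u / 2\<bar> / d)"
        using H K w1 that by (intro mult_mono) auto
      then have "X \<le> K * (4 * exp \<bar>Re u / 2\<bar> / d)" using that(1) by (rule order.trans[rotated])
      also have "\<dots> = 4 * K / d * exp \<bar>Re u / 2\<bar>" by simp
      finally show ?thesis .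
    qed
    have b1: "cmod (f w) \<le> 4 * K / d * exp \<bar>Re u / 2\<bar>"
      by (rule bd[OF Schwarz_right_half_plane[OF fhol(1) fpos w1]]) (auto simp: K_def)
    have b2: "cmod (inverse (f w)) \<le> 4 * K / d * exp \<bar>Re u / 2\<bar>"
      by (rule bd[OF Schwarz_right_half_plane[OF fhol(2) fpos' w1]]) (auto simp: K_def)
    have n: "cmod (f w) = exp (Re (L u) / 2)" "cmod (inverse (f w)) = exp (- Re (L u) / 2)"
      by (auto simp: f_def Uw norm_inverse exp_minus)
    have e: "4 * K / d * exp \<bar>Re u / 2\<bar> = exp (ln (4 * K / d) + \<bar>Re u / 2\<bar>)"
      using K d by (simp add: exp_add)
    show ?thesis using b1 b2 unfolding n e exp_le_cancel_iff by (auto simp: abs_if split: if_splits)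
  qed
  then show ?thesis by blast
qed

text \<open>Uniformise the strip so that \<open>a\<close> becomes 0. A second fixed point is then
  equality in the Schwarz lemma, so the map is a rotation and in particular onto, against the
  omitted value \<open>q\<close>. This value is what excludes automorphisms such as the
  identity.\<close>

lemma strip_fixed_point_unique:
  assumes hol: "F holomorphic_on strip" and im: "F ` strip \<subseteq> strip"
    and q: "q \<in> strip" "q \<notin> F ` strip"
    and ab: "a \<in> strip" "b \<in> strip" "F a = a" "F b = b"
  shows "a = b"
proof (rule ccontr)
  assume "a \<noteq> b"
  have "simply_connected strip"
    by (simp add: convex_imp_simply_connected convex_strip)
  moreover have "strip \<noteq> {}" "strip \<noteq> UNIV"
  proof -
    have "0 \<notin> strip" by (simp add: strip_def)
    then show "strip \<noteq> {}" "strip \<noteq> UNIV" using ab(1) by auto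
  qed
  ultimately obtain f g where f: "f holomorphic_on strip" "g holomorphic_on ball 0 1"
      "\<And>z. z \<in> strip \<Longrightarrow> f z \<in> ball 0 1 \<and> g (f z) = z"
      "\<And>z. z \<in> ball 0 1 \<Longrightarrow> g z \<in> strip \<and> f (g z) = z"
    unfolding simply_connected_eq_biholomorphic_to_disc[OF open_strip] by metis
  obtain m n where m: "m (f a) = 0" "m holomorphic_on ball 0 1" "m ` ball 0 1 \<subseteq> ball 0 1"
      "n holomorphic_on ball 0 1" "n ` ball 0 1 \<subseteq> ball 0 1"
      "\<And>z. z \<in> ball 0 1 \<Longrightarrow> m (n z) = z" "\<And>z. z \<in> ball 0 1 \<Longrightarrow> n (m z) = z"
    using ball_biholomorphism_exists[of "f a"] f(3)[OF ab(1)] by blast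
  define p where "p = m \<circ> f"
  define r where "r = g \<circ> n"
  have p: "p holomorphic_on strip"
    unfolding p_def by (rule holomorphic_on_compose_gen[OF f(1) m(2)]) (use f(3) in auto)
  have r: "r holomorphic_on ball 0 1"
    unfolding r_def by (rule holomorphic_on_compose_gen[OF m(4) f(2)]) (use m(5) in auto)
  have pin: "p u \<in> ball 0 1" "r (p u) = u" if "u \<in> strip" for u
  proof -
    have fu: "f u \<in> ball 0 1" "g (f u) = u" using f(3)[OF that] by auto
    show "p u \<in> ball 0 1" "r (p u) = u"
      using m(3) m(7)[OF fu(1)] fu by (auto simp: p_def r_def image_subset_iff)
  qed
  have rin: "r z \<in> strip" "p (r z) = z" if "z \<in> ball 0 1" for z
  proof -
    have nz: "n z \<in> ball 0 1" "m (n z) = z" using m(5,6) that by blast+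
    show "r z \<in> strip" "p (r z) = z"
      using f(4)[OF nz(1)] nz by (auto simp: p_def r_def)
  qed
  have p0: "p a = 0" using m(1) by (simp add: p_def)
  define H where "H = p \<circ> F \<circ> r"
  have Fin: "F u \<in> strip" if "u \<in> strip" for u
    using im that by blast
  have "(F \<circ> r) holomorphic_on ball 0 1"
    by (rule holomorphic_on_compose_gen[OF r hol]) (use rin in auto)
  then have "(p \<circ> (F \<circ> r)) holomorphic_on ball 0 1"
    by (rule holomorphic_on_compose_gen[OF _ p]) (use rin Fin in auto)
  then have Hhol: "H holomorphic_on ball 0 1" by (simp add: H_def o_assoc)
  have H0: "H 0 = 0" using pin(2)[OF ab(1)] ab(3) p0 by (simp add: H_def)
  have Hn: "cmod (H z) < 1" if "cmod z < 1" for z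
    using pin(1)[OF Fin[OF rin(1)[of z]]] that by (simp add: H_def)
  have pb: "cmod (p b) < 1" "p b \<noteq> 0" "cmod (H (p b)) = cmod (p b)"
    using pin[OF ab(2)] pin(2)[OF ab(1)] ab(4) p0 \<open>a \<noteq> b\<close> by (auto simp: H_def)
  then obtain \<alpha> where \<alpha>: "\<And>z. cmod z < 1 \<Longrightarrow> H z = \<alpha> * z" "cmod \<alpha> = 1"
    using Schwarz_Lemma(3)[OF Hhol H0 Hn pb(1)] by blast
  have "cmod (p q / \<alpha>) < 1"
    using pin(1)[OF q(1)] \<alpha>(2) by (simp add: norm_divide)
  then have z: "p q / \<alpha> \<in> ball 0 1" "H (p q / \<alpha>) = p q"
    using \<alpha>(1)[of "p q / \<alpha>"] \<alpha>(2) by auto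
  then have "F (r (p q / \<alpha>)) = q"
    using pin(2)[OF Fin[OF rin(1)[OF z(1)]]] pin(2)[OF q(1)] by (simp add: H_def)
  then show False
    using q(2) rin(1)[OF z(1)] by (metis imageI)
qed

lemma strip_equation_unique_solution:
  assumes hol: "L holomorphic_on strip" and im: "L ` strip \<subseteq> strip"
    and t: "t \<ge> 1" and \<zeta>: "\<zeta> \<in> strip"
  shows "\<exists>!u. u \<in> strip \<and> of_real t * u - of_real (t - 1) * L u = \<zeta>"
proof -
  define F where "F = (\<lambda>u. (\<zeta> + of_real (t - 1) * L u) / of_real t)"
  have eq: "of_real t * u - of_real (t - 1) * L u = \<zeta> \<longleftrightarrow> F u = u" for u
    using t by (auto simp: F_def field_simps)
  \<comment> \<open>\<open>F u\<close> averages \<open>\<zeta>\<close> with weight 1/t and a point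
    of the strip with weight (t - 1)/t. Its distance to each edge is therefore at least 1/t times
    that of \<open>\<zeta>\<close>.\<close>
  define e where "e = min (Im \<zeta> / t) ((2 * pi - Im \<zeta>) / t)"
  have e0: "e > 0" using t \<zeta> by (auto simp: e_def strip_def)
  have ImF: "Im (F u) = (Im \<zeta> + (t - 1) * Im (L u)) / t"
       and ReF: "Re (F u) = (Re \<zeta> + (t - 1) * Re (L u)) / t" for u
    by (auto simp: F_def)
  have Im_bd: "e \<le> Im (F u) \<and> Im (F u) \<le> 2 * pi - e" if "u \<in> strip" for u
  proof
    have L: "0 < Im (L u)" "Im (L u) < 2 * pi" using im that by (auto simp: strip_def)
    have "Im \<zeta> / t \<le> Im (F u)"
      unfolding ImF using t L by (intro divide_right_mono) auto
    then show "e \<le> Im (F u)" by (simp add: e_def)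
    have "Im \<zeta> + (t - 1) * Im (L u) \<le> Im \<zeta> + (t - 1) * (2 * pi)"
      using t L by (intro add_left_mono mult_left_mono) auto
    then have "Im (F u) \<le> (Im \<zeta> + (t - 1) * (2 * pi)) / t"
      unfolding ImF using t by (intro divide_right_mono) auto
    also have "\<dots> = 2 * pi - (2 * pi - Im \<zeta>) / t"
      using t by (simp add: field_simps)
    finally have "Im (F u) \<le> 2 * pi - (2 * pi - Im \<zeta>) / t" .
    then show "Im (F u) \<le> 2 * pi - e" by (simp add: e_def)
  qed
  have epi: "e \<le> pi" using Im_bd[OF \<zeta>] by linarith
  have Fhol: "F holomorphic_on strip"
    unfolding F_def using t by (intro holomorphic_intros hol) auto
  have Fin: "F ` strip \<subseteq> strip"
    using Im_bd e0 by (force simp: strip_def)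
  obtain C where C: "\<And>u. e \<le> Im u \<and> Im u \<le> 2 * pi - e \<Longrightarrow> \<bar>Re (L u)\<bar> \<le> \<bar>Re u\<bar> + C"
    using strip_self_map_linear_growth[OF hol im e0 epi] by blast
  \<comment> \<open>The solution of |Re zeta| + (t - 1) (R + |C|) = t R. Growth of slope one leaves
    exactly one copy of R to spare, whatever t is.\<close>
  define R where "R = \<bar>Re \<zeta>\<bar> + (t - 1) * \<bar>C\<bar>"
  define K where "K = cbox (Complex (-R) e) (Complex R (2 * pi - e))"
  have R0: "R \<ge> 0" using t by (simp add: R_def)
  have K: "u \<in> K \<longleftrightarrow> \<bar>Re u\<bar> \<le> R \<and> e \<le> Im u \<and> Im u \<le> 2 * pi - e" for u
    by (auto simp: K_def in_cbox_complex_iff)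
  have Ks: "K \<subseteq> strip" using e0 by (auto simp: K strip_def)
  have "F \<in> K \<rightarrow> K"
  proof
    fix u assume u: "u \<in> K"
    then have "\<bar>Re (L u)\<bar> \<le> R + \<bar>C\<bar>" using C[of u] by (auto simp: K)
    then have "(t - 1) * \<bar>Re (L u)\<bar> \<le> (t - 1) * (R + \<bar>C\<bar>)"
      using t by (intro mult_left_mono) auto
    moreover have "\<bar>Re (F u)\<bar> * t \<le> \<bar>Re \<zeta>\<bar> + (t - 1) * \<bar>Re (L u)\<bar>"
      using t abs_triangle_ineq[of "Re \<zeta>" "(t - 1) * Re (L u)"] by (simp add: ReF abs_mult)
    moreover have "\<bar>Re \<zeta>\<bar> + (t - 1) * (R + \<bar>C\<bar>) = R * t"
      by (simp add: R_def algebra_simps)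
    ultimately have "\<bar>Re (F u)\<bar> * t \<le> R * t" by linarith
    then have "\<bar>Re (F u)\<bar> \<le> R" using t by simp
    then show "F u \<in> K" using Im_bd[of u] u Ks by (auto simp: K)
  qed
  moreover have "continuous_on K F"
    using Fhol Ks holomorphic_on_imp_continuous_on continuous_on_subset by blast
  moreover have "Complex 0 pi \<in> K" using R0 epi by (simp add: K)
  ultimately obtain u where u: "u \<in> K" "F u = u"
    using brouwer[of K F] by (auto simp: K_def)
  have "v = u" if v: "v \<in> strip" "F v = v" for v
  proof (rule strip_fixed_point_unique[OF Fhol Fin])
    \<comment> \<open>The omitted value: every value of \<open>F\<close> has imaginary part at least
      \<open>e\<close>.\<close>
    show "Complex 0 (e / 2) \<in> strip" using e0 epi pi_gt_zero by (auto simp: strip_def)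
    show "Complex 0 (e / 2) \<notin> F ` strip"
    proof
      assume "Complex 0 (e / 2) \<in> F ` strip"
      then obtain w where "w \<in> strip" "F w = Complex 0 (e / 2)" by (metis imageE)
      then show False using Im_bd[of w] e0 by simp
    qed
  qed (use u v Ks in auto)
  then show ?thesis unfolding eq using u Ks by blast
qed

text \<open>Holomorphic dependence on the right-hand side comes from uniqueness: it makes
  \<open>G\<close> injective on the open set \<open>D\<close> of points sent into the strip, and the
  inverse of an injective holomorphic function is holomorphic.\<close>

lemma strip_equation_inverse:
  assumes hol: "L holomorphic_on strip" and im: "L ` strip \<subseteq> strip" and t: "t \<ge> 1"
  obtains W where "W holomorphic_on strip"
    and "\<And>\<zeta>. \<zeta> \<in> strip \<Longrightarrow> W \<zeta> \<in> strip"
    and "\<And>\<zeta>. \<zeta> \<in> strip \<Longrightarrow> of_real t * W \<zeta> - of_real (t - 1) * L (W \<zeta>) = \<zeta>"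
proof -
  define G where "G = (\<lambda>u. of_real t * u - of_real (t - 1) * L u)"
  define D where "D = strip \<inter> G -` strip"
  have ex1: "\<exists>!u. u \<in> strip \<and> G u = \<zeta>" if "\<zeta> \<in> strip" for \<zeta>
    unfolding G_def by (rule strip_equation_unique_solution[OF hol im t that])
  have Ghol: "G holomorphic_on strip"
    unfolding G_def by (intro holomorphic_intros hol)
  have "open D"
    unfolding D_def using Ghol open_strip holomorphic_on_imp_continuous_on
    by (intro continuous_open_preimage) auto
  have "inj_on G D"
    by (rule inj_onI) (use ex1 in \<open>auto simp: D_def\<close>)
  moreover have "G holomorphic_on D" using Ghol by (rule holomorphic_on_subset) (simp add: D_def)
  ultimately obtain g where g: "g holomorphic_on (G ` D)" "\<And>u. u \<in> D \<Longrightarrow> g (G u) = u"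
    using holomorphic_has_inverse[OF _ \<open>open D\<close>] by metis
  have GD: "G ` D = strip"
  proof
    show "strip \<subseteq> G ` D"
    proof
      fix \<zeta> assume "\<zeta> \<in> strip"
      moreover from this obtain u where "u \<in> strip" "G u = \<zeta>" using ex1 by blast
      ultimately show "\<zeta> \<in> G ` D" by (auto simp: D_def)
    qed
  qed (auto simp: D_def)
  have "g \<zeta> \<in> strip \<and> G (g \<zeta>) = \<zeta>" if "\<zeta> \<in> strip" for \<zeta>
  proof -
    have "\<zeta> \<in> G ` D" using that by (simp only: GD)
    then obtain u where u: "\<zeta> = G u" "u \<in> D" by (rule imageE)
    have "g \<zeta> = u" unfolding u(1) by (rule g(2)[OF u(2)])
    then show ?thesis using u by (simp add: D_def)
  qed
  moreover have "g holomorphic_on strip" using g(1) by (simp only: GD)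
  ultimately show ?thesis unfolding G_def by (intro that[of g]) auto
qed

section \<open>The transform of a measure on the half-line\<close>

text \<open>Compactify the half-line by tau = s / (1 + s). Then |1 - z s| / (1 + s) becomes |(1 -
  tau) - z tau|, continuous on [0, 1], and a zero would place z on the nonnegative axis.\<close>

lemma slit_linear_lower_bound:
  assumes "z \<in> slit"
  shows "\<exists>d>0. \<forall>s\<ge>0. d * (1 + s) \<le> cmod (1 - z * of_real s)"
proof -
  define h where "h = (\<lambda>\<tau>::real. cmod (of_real (1 - \<tau>) - z * of_real \<tau>))"
  have "continuous_on {0..1} h" unfolding h_def by (intro continuous_intros)
  then obtain \<tau> where \<tau>: "\<tau> \<in> {0..1}" "\<And>y. y \<in> {0..1} \<Longrightarrow> h \<tau> \<le> h y"
    using continuous_attains_inf[of "{0..1::real}" h] by auto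
  have "h \<tau> \<noteq> 0"
  proof
    assume "h \<tau> = 0"
    then have "z * of_real \<tau> = of_real (1 - \<tau>)" by (simp add: h_def)
    moreover from this have "\<tau> \<noteq> 0" by auto
    ultimately have "z = of_real ((1 - \<tau>) / \<tau>)" by (simp add: field_simps)
    moreover have "(1 - \<tau>) / \<tau> \<ge> 0" using \<tau>(1) by simp
    ultimately have "z \<in> \<real>\<^sub>\<ge>\<^sub>0" by (metis nonneg_Reals_of_real_iff)
    then show False using assms by blast
  qed
  then have "h \<tau> > 0" by (simp add: h_def)
  moreover have "h \<tau> * (1 + s) \<le> cmod (1 - z * of_real s)" if "s \<ge> 0" for s
  proof -
    have "h (s / (1 + s)) * (1 + s) = cmod ((of_real (1 - s / (1 + s)) - z * of_real (s / (1 + s))) * of_real (1 + s))"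
      unfolding h_def norm_mult norm_of_real using that by simp
    also have "(of_real (1 - s / (1 + s)) - z * of_real (s / (1 + s))) * of_real (1 + s)
        = of_real ((1 - s / (1 + s)) * (1 + s)) - z * of_real (s / (1 + s) * (1 + s))"
      unfolding of_real_mult by (simp only: left_diff_distrib mult.assoc)
    also have "\<dots> = 1 - z * of_real s"
    proof -
      have "(1 - s / (1 + s)) * (1 + s) = 1" "s / (1 + s) * (1 + s) = s"
        using that by (auto simp: field_simps)
      then show ?thesis by (simp only: of_real_1)
    qed
    finally show ?thesis
      using \<tau>(2)[of "s / (1 + s)"] that by (smt (verit) atLeastAtMost_iff divide_le_eq_1 divide_nonneg_nonneg mult_right_mono)
  qed
  ultimately show ?thesis by blast
qed

locale nonneg_distribution = real_distribution \<mu> for \<mu> +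
  assumes null_neg: "emeasure \<mu> {..<0} = 0"
begin

lemma AE_nonneg: "AE s in \<mu>. 0 \<le> s"
  by (rule AE_I[of _ _ "{..<0}"]) (use null_neg in auto)

lemma integral_cong_nonneg:
  fixes f g :: "real \<Rightarrow> 'b::{banach, second_countable_topology}"
  assumes [measurable]: "f \<in> borel_measurable borel" "g \<in> borel_measurable borel"
    and "\<And>s. 0 \<le> s \<Longrightarrow> f s = g s"
  shows "integral\<^sup>L \<mu> f = integral\<^sup>L \<mu> g"
proof (rule integral_cong_AE)
  show "AE s in \<mu>. f s = g s" using AE_nonneg by (rule AE_mp) (simp add: assms(3))
qed measurable

text \<open>On the slit plane \<open>Kint = 1 + psi \<mu>\<close> and \<open>z * Nint z = psi \<mu> z\<close>.\<close>

definition Kint :: "complex \<Rightarrow> complex" where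
  "Kint z = (LINT s|\<mu>. 1 / (1 - z * of_real s))"

definition Nint :: "complex \<Rightarrow> complex" where
  "Nint z = (LINT s|\<mu>. of_real s / (1 - z * of_real s))"

text \<open>Numerators of degree at most n over |1 - z s|^n are bounded on the half-line by
  \<open>slit_linear_lower_bound\<close>; this covers measures with infinite moments. The bound is
  stated multiplied out, with no denominators.\<close>

lemma integrable_rational:
  fixes f :: "real \<Rightarrow> 'b::{banach, second_countable_topology}"
  assumes z: "z \<in> slit" and [measurable]: "f \<in> borel_measurable borel"
    and f: "\<And>s. 0 \<le> s \<Longrightarrow> norm (f s) * cmod (1 - z * of_real s) ^ n \<le> (1 + s) ^ n"
  shows "integrable \<mu> f"
proof -
  obtain d where d: "d > 0" "\<And>s. s \<ge> 0 \<Longrightarrow> d * (1 + s) \<le> cmod (1 - z * of_real s)"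
    using slit_linear_lower_bound[OF z] by blast
  have "norm (f s) \<le> 1 / d ^ n" if "0 \<le> s" for s
  proof -
    have "norm (f s) * (d * (1 + s)) ^ n \<le> norm (f s) * cmod (1 - z * of_real s) ^ n"
      using d that by (intro mult_left_mono power_mono) auto
    also have "\<dots> \<le> (1 + s) ^ n" using f[OF that] .
    finally have "norm (f s) * (d ^ n * (1 + s) ^ n) \<le> (1 + s) ^ n"
      unfolding power_mult_distrib .
    then have "(norm (f s) * d ^ n) * (1 + s) ^ n \<le> 1 * (1 + s) ^ n"
      unfolding mult.assoc mult_1 .
    then have "norm (f s) * d ^ n \<le> 1"
      by (rule mult_right_le_imp_le) (use that in simp)
    then show ?thesis using d by (simp add: pos_le_divide_eq)
  qed
  then have "AE s in \<mu>. norm (f s) \<le> 1 / d ^ n"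
    by - (rule AE_mp[OF AE_nonneg], rule AE_I2, simp)
  then show ?thesis
    by (rule integrable_const_bound) measurable
qed

lemma slit_nonzero: "z \<in> slit \<Longrightarrow> 0 \<le> s \<Longrightarrow> 1 - z * of_real s \<noteq> 0"
  using slit_linear_lower_bound[of z]
  by (smt (verit) mult_pos_pos norm_zero)

lemma integrable_K: "z \<in> slit \<Longrightarrow> integrable \<mu> (\<lambda>s. 1 / (1 - z * of_real s))"
  by (rule integrable_rational[where z=z and n=1])
     (auto simp: norm_divide divide_simps slit_nonzero)

lemma integrable_N: "z \<in> slit \<Longrightarrow> integrable \<mu> (\<lambda>s. of_real s / (1 - z * of_real s))"
  by (rule integrable_rational[where z=z and n=1])
     (auto simp: norm_divide divide_simps slit_nonzero)

section \<open>Weighted moments and the real and imaginary parts of the transforms\<close>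

lemma integrable_moment:
  "z \<in> slit \<Longrightarrow> j \<le> 2 \<Longrightarrow> integrable \<mu> (\<lambda>s. s ^ j / (cmod (1 - z * of_real s))\<^sup>2)"
proof (rule integrable_rational[where z=z and n=2])
  fix s :: real assume z: "z \<in> slit" and s: "0 \<le> s" and j: "j \<le> 2"
  have "s ^ j \<le> (1 + s) ^ j" using s by (intro power_mono) auto
  also have "\<dots> \<le> (1 + s)\<^sup>2" using s j by (intro power_increasing) auto
  finally show "norm (s ^ j / (cmod (1 - z * of_real s))\<^sup>2) * cmod (1 - z * of_real s) ^ 2 \<le> (1 + s) ^ 2"
    using slit_nonzero[OF z s] s by (simp add: norm_divide norm_power)
qed auto

text \<open>Moments of the measure with density |1 - z s|^-2 relative to \<open>\<mu>\<close>.
  \<open>Kint\<close> and \<open>Nint\<close> are combinations of them with coefficients 1 and -cnj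
  z, so signs of imaginary parts become inequalities between real numbers.\<close>

definition moment :: "nat \<Rightarrow> complex \<Rightarrow> real" where
  "moment j z = (LINT s|\<mu>. s ^ j / (cmod (1 - z * of_real s))\<^sup>2)"

lemma rational_expand:
  assumes "z \<in> slit" "0 \<le> s"
  shows "of_real s ^ j / (1 - z * of_real s)
    = of_real (s ^ j / (cmod (1 - z * of_real s))\<^sup>2) - cnj z * of_real (s ^ Suc j / (cmod (1 - z * of_real s))\<^sup>2)"
proof -
  define q where "q = 1 - z * of_real s"
  have "q \<noteq> 0" using slit_nonzero[OF assms] by (simp add: q_def)
  then have "of_real s ^ j / q = of_real s ^ j * cnj q / of_real ((cmod q)\<^sup>2)"
    unfolding complex_norm_square by simp
  also have "\<dots> = of_real s ^ j * (1 - cnj z * of_real s) / of_real ((cmod q)\<^sup>2)"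
    by (simp add: q_def)
  also have "\<dots> = of_real (s ^ j / (cmod q)\<^sup>2) - cnj z * of_real (s ^ Suc j / (cmod q)\<^sup>2)"
    by (simp add: diff_divide_distrib algebra_simps)
  finally show ?thesis by (simp only: q_def)
qed

lemma integral_of_real_combination:
  assumes "integrable \<mu> a" "integrable \<mu> b"
  shows "(LINT s|\<mu>. of_real (a s) - c * of_real (b s)) = of_real (LINT s|\<mu>. a s) - c * complex_of_real (LINT s|\<mu>. b s)"
  using assms by simp

lemma K_moments:
  assumes z: "z \<in> slit"
  shows "Kint z = of_real (moment 0 z) - cnj z * of_real (moment 1 z)"
proof -
  have "Kint z = (LINT s|\<mu>. of_real (s ^ 0 / (cmod (1 - z * of_real s))\<^sup>2) - cnj z * of_real (s ^ 1 / (cmod (1 - z * of_real s))\<^sup>2))"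
    unfolding Kint_def using rational_expand[OF z, of _ 0]
    by (intro integral_cong_nonneg) (auto)
  also have "\<dots> = of_real (moment 0 z) - cnj z * of_real (moment 1 z)"
    unfolding moment_def using integrable_moment[OF z, of 0] integrable_moment[OF z, of 1]
    by (intro integral_of_real_combination) simp_all
  finally show ?thesis .
qed

lemma N_moments:
  assumes z: "z \<in> slit"
  shows "Nint z = of_real (moment 1 z) - cnj z * of_real (moment 2 z)"
proof -
  have "Nint z = (LINT s|\<mu>. of_real (s ^ 1 / (cmod (1 - z * of_real s))\<^sup>2) - cnj z * of_real (s ^ 2 / (cmod (1 - z * of_real s))\<^sup>2))"
    unfolding Nint_def using rational_expand[OF z, of _ 1]
    by (intro integral_cong_nonneg) (auto simp: numeral_2_eq_2)
  also have "\<dots> = of_real (moment 1 z) - cnj z * of_real (moment 2 z)"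
    unfolding moment_def using integrable_moment[OF z, of 2] integrable_moment[OF z, of 1]
    by (intro integral_of_real_combination) simp_all
  finally show ?thesis .
qed

lemma K_eq_1_plus_zN:
  assumes z: "z \<in> slit" shows "Kint z = 1 + z * Nint z"
proof -
  have "Kint z = (LINT s|\<mu>. 1 + z * (of_real s / (1 - z * of_real s)))"
    unfolding Kint_def using slit_nonzero[OF z]
    by (intro integral_cong_nonneg) (auto simp: divide_simps)
  also have "\<dots> = 1 + z * Nint z"
    unfolding Nint_def using integrable_N[OF z] prob_space
    by (subst Bochner_Integration.integral_add) (simp_all del: times_divide_eq_right)
  finally show ?thesis .
qed

lemma psi_eq:
  assumes z: "z \<in> slit" shows "psi \<mu> z = z * Nint z"
proof -
  have "psi \<mu> z = (LINT s|\<mu>. z * (of_real s / (1 - z * of_real s)))"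
    unfolding psi_def set_lebesgue_integral_def
    by (intro integral_cong_nonneg) (auto)
  then show ?thesis by (simp add: Nint_def del: times_divide_eq_right)
qed

lemma eta_eq: "z \<in> slit \<Longrightarrow> eta \<mu> z = z * Nint z / Kint z"
  by (simp add: eta_def psi_eq K_eq_1_plus_zN)

section \<open>Holomorphy and conjugation symmetry\<close>

lemma K_has_derivative:
  assumes z: "z \<in> slit"
  shows "\<exists>D. (Kint has_field_derivative D) (at z)"
proof -
  obtain d where d: "d > 0" "\<And>s. s \<ge> 0 \<Longrightarrow> d * (1 + s) \<le> cmod (1 - z * of_real s)"
    using slit_linear_lower_bound[OF z] by blast
  define D where "D = (LINT s|\<mu>. of_real s / (1 - z * of_real s)\<^sup>2)"
  have intD: "integrable \<mu> (\<lambda>s. of_real s / (1 - z * of_real s)\<^sup>2)"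
  proof (rule integrable_rational[OF z, where n=2])
    fix s :: real assume s: "0 \<le> s"
    have "s * 1 \<le> (1 + s) * (1 + s)" using s by (intro mult_mono) auto
    then show "norm (of_real s / (1 - z * of_real s)\<^sup>2) * cmod (1 - z * of_real s) ^ 2 \<le> (1 + s) ^ 2"
      using slit_nonzero[OF z s] s
      unfolding norm_divide norm_power by (simp add: power2_eq_square)
  qed measurable
  have bound: "norm ((Kint w - Kint z) / (w - z) - D) \<le> 2 / d ^ 3 * norm (w - z)"
    if w: "w \<in> slit" "w \<noteq> z" "norm (w - z) < d / 2" for w
  proof -
    \<comment> \<open>The integrand of the remainder of the difference quotient. Its denominator is
      cubic in 1 + s and its numerator quadratic, so it is O(|w - z|) uniformly in s.\<close>
    define E where "E = (\<lambda>s. (w - z) * of_real (s\<^sup>2) / ((1 - w * of_real s) * (1 - z * of_real s)\<^sup>2))"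
    have eq: "(1 / (1 - w * of_real s) - 1 / (1 - z * of_real s)) / (w - z) - of_real s / (1 - z * of_real s)\<^sup>2 = E s"
      if "s \<ge> 0" for s
    proof -
      have nz: "1 - w * of_real s \<noteq> 0" "1 - z * of_real s \<noteq> 0" "w - z \<noteq> 0"
        using slit_nonzero w z that by auto
      have "1 / (1 - w * of_real s) - 1 / (1 - z * of_real s)
          = (w - z) * of_real s / ((1 - w * of_real s) * (1 - z * of_real s))"
        using nz by (simp add: divide_simps) (simp add: algebra_simps)
      then have "(1 / (1 - w * of_real s) - 1 / (1 - z * of_real s)) / (w - z)
          = of_real s / ((1 - w * of_real s) * (1 - z * of_real s))"
        using nz by simp
      moreover have "of_real s / ((1 - w * of_real s) * (1 - z * of_real s)) - of_real s / (1 - z * of_real s)\<^sup>2 = E s"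
        unfolding E_def using nz by (simp add: divide_simps) (simp add: algebra_simps power2_eq_square)
      ultimately show ?thesis by simp
    qed
    have "(Kint w - Kint z) / (w - z) - D = (LINT s|\<mu>. (1 / (1 - w * of_real s) - 1 / (1 - z * of_real s)) / (w - z) - of_real s / (1 - z * of_real s)\<^sup>2)"
      unfolding Kint_def D_def using integrable_K[OF z] integrable_K[OF w(1)] intD
      by simp
    also have "\<dots> = (LINT s|\<mu>. E s)"
      using eq unfolding E_def by (intro integral_cong_nonneg) auto
    finally have *: "(Kint w - Kint z) / (w - z) - D = (LINT s|\<mu>. E s)" .
    have Eb: "norm (E s) \<le> 2 / d ^ 3 * norm (w - z)" if s: "s \<ge> 0" for s
    proof -
      have "cmod (1 - z * of_real s) \<le> cmod (1 - w * of_real s) + cmod ((w - z) * of_real s)"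
        using norm_triangle_ineq[of "1 - w * of_real s" "(w - z) * of_real s"] by (simp add: algebra_simps)
      moreover have "cmod ((w - z) * of_real s) \<le> d / 2 * (1 + s)"
        unfolding norm_mult using s w d(1) by (intro mult_mono) auto
      \<comment> \<open>As |w - z| < d / 2, half of the linear lower bound at \<open>z\<close>
        survives at \<open>w\<close>.\<close>
      ultimately have b1: "d / 2 * (1 + s) \<le> cmod (1 - w * of_real s)"
        using d(2)[OF s] by (simp add: field_simps)
      have b2: "(d * (1 + s))\<^sup>2 \<le> (cmod (1 - z * of_real s))\<^sup>2"
        using d s by (intro power_mono) auto
      have "norm (E s) = norm (w - z) * s\<^sup>2 / (cmod (1 - w * of_real s) * (cmod (1 - z * of_real s))\<^sup>2)"
        by (simp add: E_def norm_mult norm_divide norm_power)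
      also have "\<dots> \<le> norm (w - z) * (1 + s) ^ 3 / ((d / 2 * (1 + s)) * (d * (1 + s))\<^sup>2)"
      proof (intro frac_le mult_mono b1 b2)
        have "s\<^sup>2 \<le> (1 + s)\<^sup>2" using s by (intro power_mono) auto
        also have "\<dots> \<le> (1 + s) ^ 3" using s by (intro power_increasing) auto
        finally show "s\<^sup>2 \<le> (1 + s) ^ 3" .
      qed (use s d in auto)
      also have "\<dots> = 2 / d ^ 3 * norm (w - z)"
        using s d by (simp add: divide_simps power2_eq_square power3_eq_cube)
      finally show ?thesis .
    qed
    have "cmod (LINT s|\<mu>. E s) \<le> (LINT s|\<mu>. cmod (E s))" by (rule integral_norm_bound)
    also have "\<dots> \<le> (LINT s|\<mu>. 2 / d ^ 3 * norm (w - z))"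
    proof (rule integral_mono_AE')
      show "AE s in \<mu>. cmod (E s) \<le> 2 / d ^ 3 * norm (w - z)"
        by (rule AE_mp[OF AE_nonneg], rule AE_I2, rule impI, rule Eb)
    qed (use d in auto)
    finally show ?thesis unfolding * using prob_space by simp
  qed
  have "((\<lambda>w. (Kint w - Kint z) / (w - z) - D) \<longlongrightarrow> 0) (at z)"
  proof (rule Lim_null_comparison)
    show "\<forall>\<^sub>F w in at z. norm ((Kint w - Kint z) / (w - z) - D) \<le> 2 / d ^ 3 * norm (w - z)"
    proof -
      have "\<forall>\<^sub>F w in at z. w \<in> slit" using open_slit z by (rule eventually_at_in_open')
      moreover have "\<forall>\<^sub>F w in at z. w \<in> ball z (d/2)" using d by (intro eventually_at_in_open') auto
      moreover have "\<forall>\<^sub>F w in at z. w \<noteq> z" by (simp add: eventually_at_filter)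
      ultimately show ?thesis by eventually_elim (intro bound; simp add: dist_norm norm_minus_commute)
    qed
    show "((\<lambda>w. 2 / d ^ 3 * norm (w - z)) \<longlongrightarrow> 0) (at z)"
      using d(1) by (auto intro!: tendsto_eq_intros)
  qed
  then have "(Kint has_field_derivative D) (at z)"
    unfolding has_field_derivative_iff by (rule LIM_zero_cancel)
  then show ?thesis by blast
qed

lemma holomorphic_K: "Kint holomorphic_on slit"
  using K_has_derivative open_slit by (auto simp: holomorphic_on_open)

lemma K_cnj: "Kint (cnj z) = cnj (Kint z)"
proof -
  have "(\<lambda>s. 1 / (1 - cnj z * of_real s)) = (\<lambda>s. cnj (1 / (1 - z * of_real s)))"
    by simp
  then show ?thesis unfolding Kint_def by (simp only: Bochner_Integration.integral_cnj)
qed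

section \<open>Strict positivity and the argument of eta\<close>

lemma AE_zero_imp_delta0:
  assumes "AE s in \<mu>. s = 0" shows "\<mu> = delta0"
proof (rule measure_eqI)
  fix A assume A: "A \<in> sets \<mu>"
  have "emeasure \<mu> A = emeasure \<mu> (if 0 \<in> A then UNIV else {})"
    using A by (intro emeasure_eq_AE AE_mp[OF assms AE_I2]) auto
  also have "\<dots> = indicator A 0"
    using emeasure_space_1 by simp
  finally show "emeasure \<mu> A = emeasure delta0 A"
    using A by simp
qed simp

text \<open>An integrand allowed to vanish only at 0 has integral 0 only against the point mass at
  0. The strict inequalities below draw on \<open>\<mu> \<noteq> delta0\<close> through
  this.\<close>

lemma integral_positive:
  fixes f :: "real \<Rightarrow> real"
  assumes "\<mu> \<noteq> delta0" and int: "integrable \<mu> f"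
    and nonneg: "\<And>s. 0 \<le> s \<Longrightarrow> 0 \<le> f s" and pos: "\<And>s. 0 < s \<Longrightarrow> 0 < f s"
  shows "0 < integral\<^sup>L \<mu> f"
proof -
  have ae: "AE s in \<mu>. 0 \<le> f s"
    by (rule AE_mp[OF AE_nonneg], rule AE_I2, rule impI, rule nonneg)
  have "integral\<^sup>L \<mu> f \<noteq> 0"
  proof
    assume "integral\<^sup>L \<mu> f = 0"
    then have "AE s in \<mu>. f s = 0"
      using integral_nonneg_eq_0_iff_AE[OF int ae] by simp
    with AE_nonneg have "AE s in \<mu>. s = 0"
      by eventually_elim (metis pos order_less_irrefl order_le_less)
    then show False using assms(1) AE_zero_imp_delta0 by blast
  qed
  then show ?thesis using integral_nonneg_AE[OF ae] by linarith
qed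

lemma moment_positive:
  assumes "\<mu> \<noteq> delta0" "z \<in> slit" "j \<le> 2"
  shows "0 < moment j z"
  unfolding moment_def
proof (rule integral_positive[OF assms(1) integrable_moment[OF assms(2,3)]])
  fix s :: real assume s: "0 < s"
  have "0 < cmod (1 - z * of_real s)"
    using slit_nonzero[OF assms(2), of s] s by (simp only: zero_less_norm_iff) auto
  then show "0 < s ^ j / (cmod (1 - z * of_real s))\<^sup>2" using s by simp
qed simp

lemma moment_Cauchy_Schwarz:
  assumes "\<mu> \<noteq> delta0" and z: "z \<in> slit"
  shows "(moment 1 z)\<^sup>2 \<le> moment 0 z * moment 2 z"
proof -
  define q where "q = (\<lambda>s. (cmod (1 - z * of_real s))\<^sup>2)"
  \<comment> \<open>The mean of the weighted measure, which minimises the integral of (s - r)^2 / q;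
    the minimum is m2 - m1^2 / m0.\<close>
  define r where "r = moment 1 z / moment 0 z"
  have int: "integrable \<mu> (\<lambda>s. 1 / q s)" "integrable \<mu> (\<lambda>s. s / q s)" "integrable \<mu> (\<lambda>s. s\<^sup>2 / q s)"
    using integrable_moment[OF z, of 0] integrable_moment[OF z, of 1] integrable_moment[OF z, of 2]
    by (simp_all add: q_def)
  have m: "moment 0 z = (LINT s|\<mu>. 1 / q s)" "moment 1 z = (LINT s|\<mu>. s / q s)"
     "moment 2 z = (LINT s|\<mu>. s\<^sup>2 / q s)"
    by (simp_all add: moment_def q_def)
  have "0 \<le> (LINT s|\<mu>. (s - r)\<^sup>2 / q s)"
    by (rule Bochner_Integration.integral_nonneg) (simp add: q_def)
  also have "(\<lambda>s. (s - r)\<^sup>2 / q s) = (\<lambda>s. s\<^sup>2 / q s - 2 * r * (s / q s) + r\<^sup>2 * (1 / q s))"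
    by (auto simp: power2_diff diff_divide_distrib add_divide_distrib)
  also have "(LINT s|\<mu>. s\<^sup>2 / q s - 2 * r * (s / q s) + r\<^sup>2 * (1 / q s))
      = moment 2 z - 2 * r * moment 1 z + r\<^sup>2 * moment 0 z"
    unfolding m using int by (simp del: times_divide_eq_right)
  also have "\<dots> = moment 2 z - (moment 1 z)\<^sup>2 / moment 0 z"
    using moment_positive[OF assms, of 0] by (simp add: r_def field_simps power2_eq_square)
  finally show ?thesis
    using moment_positive[OF assms, of 0] by (simp add: field_simps)
qed

lemma Im_K: "z \<in> slit \<Longrightarrow> Im (Kint z) = Im z * moment 1 z"
  by (simp add: K_moments)

lemma K_nonzero:
  assumes "\<mu> \<noteq> delta0" and z: "z \<in> slit"
  shows "Kint z \<noteq> 0"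
proof (cases "Im z = 0")
  case True
  then have "Re z < 0" using z by (simp add: complex_nonneg_Reals_iff)
  then have "0 < moment 0 z - Re z * moment 1 z"
    using moment_positive[OF assms, of 0] mult_neg_pos[of "Re z" "moment 1 z"]
      moment_positive[OF assms, of 1] by linarith
  then have "Re (Kint z) > 0" using z by (simp add: K_moments)
  then show ?thesis by auto
next
  case False
  then have "Im (Kint z) \<noteq> 0" using z moment_positive[OF assms, of 1] by (simp add: Im_K)
  then show ?thesis by auto
qed

lemma eta_eq_1_minus_inverse:
  assumes "\<mu> \<noteq> delta0" and z: "z \<in> slit"
  shows "eta \<mu> z = 1 - 1 / Kint z"
  using K_nonzero[OF assms] K_eq_1_plus_zN[OF z] by (simp add: eta_eq[OF z] field_simps)

lemma holomorphic_eta: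
  assumes "\<mu> \<noteq> delta0" shows "eta \<mu> holomorphic_on slit"
proof -
  have "(\<lambda>z. 1 - 1 / Kint z) holomorphic_on slit"
    using K_nonzero[OF assms] by (intro holomorphic_intros holomorphic_K) auto
  then show ?thesis
    by (rule holomorphic_transform) (simp add: eta_eq_1_minus_inverse[OF assms])
qed

lemma eta_cnj:
  assumes "\<mu> \<noteq> delta0" "z \<in> slit" shows "eta \<mu> (cnj z) = cnj (eta \<mu> z)"
  unfolding eta_eq_1_minus_inverse[OF assms] eta_eq_1_minus_inverse[OF assms(1) cnj_slit[OF assms(2)]] K_cnj
  by simp

lemma Im_eta_pos:
  assumes "\<mu> \<noteq> delta0" and "Im z > 0"
  shows "Im (eta \<mu> z) > 0"
proof -
  have z: "z \<in> slit" using assms by (simp add: complex_nonneg_Reals_iff)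
  have "Im (Kint z) > 0" using assms moment_positive[OF assms(1) z, of 1] by (simp add: Im_K[OF z])
  moreover from this have "(Re (Kint z))\<^sup>2 + (Im (Kint z))\<^sup>2 > 0" by (simp add: sum_power2_gt_zero_iff)
  ultimately show ?thesis
    by (simp add: eta_eq_1_minus_inverse[OF assms(1) z] Im_divide)
qed

text \<open>The inequality arg z <= arg eta(z) without arguments. As eta = z N / K, its sign is that
  of Im (N cnj K), which the moment formulas turn into Im z times the Cauchy-Schwarz difference m0
  m2 - m1^2.\<close>

lemma Im_eta_cnj_nonneg:
  assumes "\<mu> \<noteq> delta0" and "Im z > 0"
  shows "Im (eta \<mu> z * cnj z) \<ge> 0"
proof -
  have z: "z \<in> slit" using assms by (simp add: complex_nonneg_Reals_iff)
  define A B C where "A = moment 1 z" and "B = moment 0 z" and "C = moment 2 z"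
  have "eta \<mu> z * cnj z = of_real ((cmod z)\<^sup>2 / (cmod (Kint z))\<^sup>2) * (Nint z * cnj (Kint z))"
    using K_nonzero[OF assms(1) z]
    unfolding eta_eq[OF z] of_real_divide complex_norm_square by simp
  then have "Im (eta \<mu> z * cnj z) = (cmod z)\<^sup>2 / (cmod (Kint z))\<^sup>2 * Im (Nint z * cnj (Kint z))"
    by (simp only: times_complex.sel Re_complex_of_real Im_complex_of_real mult_zero_left add_0_right)
  moreover have "Im (Nint z * cnj (Kint z)) = Im z * (B * C - A\<^sup>2)"
    unfolding N_moments[OF z] K_moments[OF z] A_def[symmetric] B_def[symmetric] C_def[symmetric]
    by (simp add: algebra_simps power2_eq_square)
  moreover have "B * C - A\<^sup>2 \<ge> 0"
    using moment_Cauchy_Schwarz[OF assms(1) z] by (simp add: A_def B_def C_def)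
  ultimately show ?thesis using assms(2) by simp
qed

section \<open>The transform on the negative axis\<close>

definition Kreal :: "real \<Rightarrow> real" where
  "Kreal x = (LINT s|\<mu>. 1 / (1 - x * s))"

lemma K_of_real: "Kint (of_real x) = of_real (Kreal x)"
proof -
  have "(\<lambda>s. 1 / (1 - of_real x * of_real s)) = (\<lambda>s. complex_of_real (1 / (1 - x * s)))" by simp
  then show ?thesis unfolding Kint_def Kreal_def by (simp only: integral_complex_of_real)
qed

lemma integrable_Kreal:
  assumes "x < 0" shows "integrable \<mu> (\<lambda>s. 1 / (1 - x * s))"
proof (rule integrable_rational[OF neg_in_slit[OF assms], where n=1])
  fix s :: real assume "0 \<le> s"
  then have "1 - x * s > 0" using assms by (smt (verit) mult_nonneg_nonpos2)
  moreover have "1 - of_real x * of_real s = complex_of_real (1 - x * s)" by simp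
  ultimately show "norm (1 / (1 - x * s)) * cmod (1 - of_real x * of_real s) ^ 1 \<le> (1 + s) ^ 1"
    using \<open>0 \<le> s\<close> by (simp only: norm_of_real) simp
qed measurable

lemma Kreal_strict_mono:
  assumes "\<mu> \<noteq> delta0" "x < y" "y < 0"
  shows "Kreal x < Kreal y"
proof -
  have x: "x < 0" using assms by simp
  have "0 < (LINT s|\<mu>. 1 / (1 - y * s) - 1 / (1 - x * s))"
  proof (rule integral_positive[OF assms(1)])
    fix s :: real
    show "0 < 1 / (1 - y * s) - 1 / (1 - x * s)" if "0 < s"
    proof -
      have "x * s < y * s" "y * s < 0" using that assms by (auto simp: mult_neg_pos)
      then show ?thesis by (simp add: frac_less2)
    qed
    then show "0 \<le> 1 / (1 - y * s) - 1 / (1 - x * s)" if "0 \<le> s"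
      using that by (cases "s = 0") auto
  qed (use integrable_Kreal x assms in auto)
  then show ?thesis unfolding Kreal_def using integrable_Kreal x assms by simp
qed

lemma Kreal_bounds:
  assumes "\<mu> \<noteq> delta0" "x < 0"
  shows "0 < Kreal x" "Kreal x < 1"
proof -
  have pos: "1 - x * s > 0" if "0 \<le> s" for s using that assms by (smt (verit) mult_nonneg_nonpos2)
  show "0 < Kreal x" unfolding Kreal_def
    by (rule integral_positive[OF assms(1) integrable_Kreal[OF assms(2)]]) (use pos in \<open>auto simp: less_imp_le\<close>)
  have "0 < (LINT s|\<mu>. 1 - 1 / (1 - x * s))"
  proof (rule integral_positive[OF assms(1)])
    fix s :: real
    show "0 \<le> 1 - 1 / (1 - x * s)" if "0 \<le> s"
      using pos[OF that] that assms by (simp add: mult_nonpos_nonneg)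
    show "0 < 1 - 1 / (1 - x * s)" if "0 < s"
      using pos[of s] that assms by (simp add: mult_neg_pos)
  qed (use integrable_Kreal assms in auto)
  then show "Kreal x < 1"
    unfolding Kreal_def using integrable_Kreal[OF assms(2)] prob_space by simp
qed

lemma Kreal_tendsto_1: "(Kreal \<longlongrightarrow> 1) (at_left 0)"
proof (rule tendsto_at_left_sequentially[of "-1"])
  fix S :: "nat \<Rightarrow> real" assume S: "\<And>n. S n < 0" "S \<longlonglongrightarrow> 0"
  have "(\<lambda>n. LINT s|\<mu>. 1 / (1 - S n * s)) \<longlonglongrightarrow> (LINT s|\<mu>. 1)"
  proof (rule integral_dominated_convergence[where w = "\<lambda>_. 1"])
    show "AE s in \<mu>. (\<lambda>n. 1 / (1 - S n * s)) \<longlonglongrightarrow> 1"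
      by (rule AE_I2) (auto intro!: tendsto_eq_intros S(2))
    show "AE s in \<mu>. norm (1 / (1 - S n * s)) \<le> 1" for n
    proof (rule AE_mp[OF AE_nonneg], rule AE_I2, rule impI)
      fix s :: real assume "0 \<le> s"
      then have "1 - S n * s \<ge> 1" using S(1)[of n] by (simp add: mult_nonpos_nonneg)
      then show "norm (1 / (1 - S n * s)) \<le> 1" by simp
    qed
  qed auto
  then show "(\<lambda>n. Kreal (S n)) \<longlonglongrightarrow> 1" unfolding Kreal_def using prob_space by simp
qed simp

definition eta_real :: "real \<Rightarrow> real" where
  "eta_real x = 1 - 1 / Kreal x"

lemma eta_of_real:
  assumes "\<mu> \<noteq> delta0" "x < 0" shows "eta \<mu> (of_real x) = of_real (eta_real x)"
  using assms by (simp add: eta_eq_1_minus_inverse neg_in_slit K_of_real eta_real_def)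

lemma eta_real_neg:
  assumes "\<mu> \<noteq> delta0" "x < 0" shows "eta_real x < 0"
  using Kreal_bounds[OF assms] by (simp add: eta_real_def)

lemma eta_real_strict_mono:
  assumes "\<mu> \<noteq> delta0" "x < y" "y < 0" shows "eta_real x < eta_real y"
  using Kreal_strict_mono[OF assms] Kreal_bounds(1)[OF assms(1), of x] assms
  by (simp add: eta_real_def frac_less2)

lemma eta_real_tendsto_0: "(eta_real \<longlongrightarrow> 0) (at_left 0)"
  unfolding eta_real_def by (auto intro!: tendsto_eq_intros Kreal_tendsto_1)

lemma eta_in_slit:
  assumes "\<mu> \<noteq> delta0" "z \<in> slit" shows "eta \<mu> z \<in> slit"
proof -
  consider "Im z > 0" | "Im (cnj z) > 0" | "Im z = 0"
    by (cases "Im z" "0::real" rule: linorder_cases) auto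
  then show ?thesis
  proof cases
    case 1
    then show ?thesis using Im_eta_pos[OF assms(1) 1] by (simp add: complex_nonneg_Reals_iff)
  next
    case 2
    then show ?thesis using Im_eta_pos[OF assms(1) 2] eta_cnj[OF assms] by (simp add: complex_nonneg_Reals_iff)
  next
    case 3
    then have "z = of_real (Re z)" "Re z < 0"
      using assms(2) by (auto simp: complex_eq_iff complex_nonneg_Reals_iff)
    then show ?thesis
      using eta_of_real[OF assms(1)] eta_real_neg[OF assms(1)] neg_in_slit by metis
  qed
qed

lemma eta_inv_eta:
  assumes "\<mu> \<noteq> delta0" "x < 0" shows "eta_inv \<mu> (eta \<mu> (of_real x)) = of_real x"
  unfolding eta_inv_def
proof (rule inv_into_f_f)
  show "inj_on (eta \<mu>) neg_axis"
  proof (rule inj_onI, clarify)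
    fix a b :: real assume ab: "a < 0" "b < 0" "eta \<mu> (of_real a) = eta \<mu> (of_real b)"
    then have "eta_real a = eta_real b" by (simp add: eta_of_real[OF assms(1)])
    then show "complex_of_real a = of_real b"
      using eta_real_strict_mono[OF assms(1)] ab by (metis linorder_neqE_linordered_idom order_less_irrefl)
  qed
qed (use assms in simp)

text \<open>This puts a left neighbourhood of 0 inside the range of eta on the negative axis, where
  \<open>eta_inv\<close> is meaningful. The point -1 is an arbitrary choice.\<close>

lemma eta_real_surj:
  assumes nd: "\<mu> \<noteq> delta0" and x: "eta_real (-1) < x" "x < 0"
  shows "\<exists>y<0. eta_real y = x"
proof -
  have "\<forall>\<^sub>F y in at_left 0. x < eta_real y"
    using eta_real_tendsto_0 x(2) by (rule order_tendstoD)
  moreover have "\<forall>\<^sub>F y in at_left (0::real). y \<in> {-1<..<0}"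
    by (rule eventually_at_left_real) simp
  ultimately have "\<forall>\<^sub>F y in at_left (0::real). x < eta_real y \<and> y \<in> {-1<..<0}"
    by (rule eventually_conj)
  then obtain b where b: "x < eta_real b" "b \<in> {-1<..<0}"
    using eventually_happens'[OF trivial_limit_at_left_real] by blast
  have "continuous_on {-1..b} (\<lambda>x. Kint (of_real x))"
    by (rule continuous_on_compose2[OF holomorphic_on_imp_continuous_on[OF holomorphic_K]])
       (use b in \<open>auto intro!: continuous_intros simp: complex_nonneg_Reals_iff\<close>)
  then have "continuous_on {-1..b} (\<lambda>x. Re (Kint (of_real x)))"
    by (rule continuous_on_Re)
  then have "continuous_on {-1..b} Kreal" by (simp add: K_of_real)
  moreover have "Kreal x \<noteq> 0" if "x \<in> {-1..b}" for x
    using Kreal_bounds(1)[OF nd, of x] b that by auto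
  ultimately have "continuous_on {-1..b} eta_real"
    unfolding eta_real_def by (intro continuous_intros) auto
  then obtain y where "-1 \<le> y" "y \<le> b" "eta_real y = x"
    using IVT'[of eta_real "-1" x b] x b by auto
  moreover from this have "y < 0" using b by simp
  ultimately show ?thesis by blast
qed

section \<open>The self-map of the strip induced by eta\<close>

definition Leta :: "complex \<Rightarrow> complex" where
  "Leta u = slog (eta \<mu> (exp u))"

lemma exp_Leta: "\<mu> \<noteq> delta0 \<Longrightarrow> u \<in> strip \<Longrightarrow> exp (Leta u) = eta \<mu> (exp u)"
  unfolding Leta_def by (intro exp_slog eta_in_slit exp_in_slit)

lemma Leta_in_strip: "\<mu> \<noteq> delta0 \<Longrightarrow> u \<in> strip \<Longrightarrow> Leta u \<in> strip"
  unfolding Leta_def by (intro slog_in_strip eta_in_slit exp_in_slit)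

lemma holomorphic_Leta:
  assumes "\<mu> \<noteq> delta0" shows "Leta holomorphic_on strip"
proof -
  have "(eta \<mu> \<circ> exp) holomorphic_on strip"
    by (rule holomorphic_on_compose_gen[OF _ holomorphic_eta[OF assms]])
       (use exp_in_slit in \<open>auto intro: holomorphic_intros\<close>)
  then have "(slog \<circ> (eta \<mu> \<circ> exp)) holomorphic_on strip"
    by (rule holomorphic_on_compose_gen[OF _ holomorphic_slog])
       (use exp_in_slit eta_in_slit[OF assms] in auto)
  then show ?thesis by (simp add: o_def Leta_def[abs_def])
qed

text \<open>In the strip, conjugation is reflection in the midline; this transfers the estimates for
  the lower half of the strip to the upper half.\<close>

lemma Leta_reflect:
  assumes "\<mu> \<noteq> delta0" and u: "u \<in> strip"
  shows "Leta (cnj u + 2 * \<i> * of_real pi) = cnj (Leta u) + 2 * \<i> * of_real pi"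
proof -
  have "exp (cnj u + 2 * \<i> * of_real pi) = cnj (exp u)"
  proof -
    have "2 * \<i> * complex_of_real pi = 2 * of_real pi * \<i>" by (simp add: complex_eq_iff)
    then show ?thesis by (simp only: exp_add exp_two_pi_i exp_cnj mult_1_right)
  qed
  then show ?thesis
    unfolding Leta_def using eta_cnj[OF assms(1) exp_in_slit[OF u]]
      slog_cnj[OF eta_in_slit[OF assms(1) exp_in_slit[OF u]]] by simp
qed

lemma Im_Leta_lower:
  assumes nd: "\<mu> \<noteq> delta0" and u: "0 < Im u" "Im u < pi"
  shows "Im u \<le> Im (Leta u)" "Im (Leta u) < pi"
proof -
  have us: "u \<in> strip" using u by (simp add: strip_def)
  have L: "0 < Im (Leta u)" "Im (Leta u) < 2 * pi"
    using Leta_in_strip[OF nd us] by (auto simp: strip_def)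
  have z: "Im (exp u) > 0" using u by (simp add: Im_exp sin_gt_zero)
  have "Im (exp (Leta u)) > 0"
    unfolding exp_Leta[OF nd us] by (rule Im_eta_pos[OF nd z])
  then have s: "sin (Im (Leta u)) > 0" by (simp add: Im_exp zero_less_mult_iff)
  show *: "Im (Leta u) < pi"
    using sin_le_zero[of "Im (Leta u)"] L(2) s by linarith
  have "Im (exp (Leta u) * cnj (exp u)) \<ge> 0"
    unfolding exp_Leta[OF nd us] by (rule Im_eta_cnj_nonneg[OF nd z])
  also have "exp (Leta u) * cnj (exp u) = exp (Leta u + cnj u)"
    by (simp add: exp_add exp_cnj)
  finally have "sin (Im (Leta u) - Im u) \<ge> 0"
    by (simp add: Im_exp zero_le_mult_iff)
  \<comment> \<open>Otherwise the difference of the imaginary parts would lie in (-pi, 0), where the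
    sine is negative.\<close>
  then show "Im u \<le> Im (Leta u)"
    using sin_gt_zero[of "Im u - Im (Leta u)"] sin_minus[of "Im (Leta u) - Im u"] u L by force
qed

lemma Im_Leta_midline:
  assumes nd: "\<mu> \<noteq> delta0" and u: "Im u = pi"
  shows "Im (Leta u) = pi"
proof -
  have "u = of_real (Re u) + \<i> * of_real pi" using u by (simp add: complex_eq_iff)
  then have "exp u = of_real (- exp (Re u))" using exp_midline by metis
  then have "eta \<mu> (exp u) = of_real (eta_real (- exp (Re u)))" using eta_of_real[OF nd, of "- exp (Re u)"] by simp
  then show ?thesis
    unfolding Leta_def using eta_real_neg[OF nd, of "- exp (Re u)"] by (simp add: slog_neg)
qed

lemma Im_Leta_upper:
  assumes nd: "\<mu> \<noteq> delta0" and u: "pi < Im u" "Im u < 2 * pi"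
  shows "Im (Leta u) \<le> Im u" "pi < Im (Leta u)"
proof -
  have us: "u \<in> strip" using u pi_gt_zero by (simp add: strip_def)
  have "Im (Leta (cnj u + 2 * \<i> * of_real pi)) = 2 * pi - Im (Leta u)"
    unfolding Leta_reflect[OF nd us] by simp
  then show "Im (Leta u) \<le> Im u" "pi < Im (Leta u)"
    using Im_Leta_lower[OF nd, of "cnj u + 2 * \<i> * of_real pi"] u by auto
qed

text \<open>Taking imaginary parts, Im zeta = Im u + (t - 1) (Im u - Im (Leta u)). As
  \<open>Leta\<close> moves points weakly towards the midline without crossing it, zeta lies on the
  same side as \<open>u\<close> and no closer to the midline.\<close>

lemma Im_solution:
  assumes nd: "\<mu> \<noteq> delta0" and t: "1 \<le> t" and u: "u \<in> strip"
    and eq: "of_real t * u - of_real (t - 1) * Leta u = \<zeta>"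
  shows "Im \<zeta> = pi \<Longrightarrow> Im u = pi"
    and "Im \<zeta> < pi \<Longrightarrow> Im \<zeta> \<le> Im u \<and> Im u < pi"
    and "Im \<zeta> \<le> pi \<Longrightarrow> Im \<zeta> \<le> Im (Leta u) \<and> Im (Leta u) \<le> pi"
    and "pi \<le> Im \<zeta> \<Longrightarrow> pi \<le> Im (Leta u) \<and> Im (Leta u) \<le> Im \<zeta>"
proof -
  have us: "0 < Im u" "Im u < 2 * pi" using u by (auto simp: strip_def)
  have "Im \<zeta> = t * Im u - (t - 1) * Im (Leta u)" by (simp flip: eq)
  then have I: "Im \<zeta> = Im u + (t - 1) * (Im u - Im (Leta u))" by (simp add: algebra_simps)
  have "(Im u < pi \<and> Im u \<le> Im (Leta u) \<and> Im (Leta u) < pi \<and> Im \<zeta> \<le> Im u)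
      \<or> (Im u = pi \<and> Im (Leta u) = pi \<and> Im \<zeta> = pi)
      \<or> (pi < Im u \<and> Im (Leta u) \<le> Im u \<and> pi < Im (Leta u) \<and> Im u \<le> Im \<zeta>)"
  proof (cases "Im u" pi rule: linorder_cases)
    case less
    note l = Im_Leta_lower[OF nd us(1) less]
    then have "(t - 1) * (Im u - Im (Leta u)) \<le> 0" using t by (simp add: mult_nonneg_nonpos)
    then show ?thesis using l less I by simp
  next
    case equal
    then show ?thesis using Im_Leta_midline[OF nd equal] I by simp
  next
    case greater
    note l = Im_Leta_upper[OF nd greater us(2)]
    then have "(t - 1) * (Im u - Im (Leta u)) \<ge> 0" using t by simp
    then show ?thesis using l greater I by simp
  qed
  then show "Im \<zeta> = pi \<Longrightarrow> Im u = pi"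
    and "Im \<zeta> < pi \<Longrightarrow> Im \<zeta> \<le> Im u \<and> Im u < pi"
    and "Im \<zeta> \<le> pi \<Longrightarrow> Im \<zeta> \<le> Im (Leta u) \<and> Im (Leta u) \<le> pi"
    and "pi \<le> Im \<zeta> \<Longrightarrow> pi \<le> Im (Leta u) \<and> Im (Leta u) \<le> Im \<zeta>"
    by linarith+
qed

text \<open>With E = eta(exp u), the argument bounds for E are equivalent to Re (-E / y) >= 0.
  Adding Re (1 / y) > 0 gives (1 - E) / y, whose inverse is y K.\<close>

lemma Re_half_plane_K:
  assumes nd: "\<mu> \<noteq> delta0" and t: "1 \<le> t" and u: "u \<in> strip"
    and eq: "of_real t * u - of_real (t - 1) * Leta u = slog (- (y\<^sup>2))" and y: "0 < Re y"
  shows "0 \<le> Re (y * Kint (exp u))"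
proof -
  define \<zeta> where "\<zeta> = 2 * Ln y + \<i> * of_real pi"
  have y0: "y \<noteq> 0" using y by auto
  have "\<bar>Im (Ln y)\<bar> < pi / 2" using Re_Ln_pos_lt[OF y0] y by simp
  then have \<zeta>s: "\<zeta> \<in> strip" by (auto simp: \<zeta>_def strip_def)
  have "exp \<zeta> = - (y\<^sup>2)"
    using y0 by (simp add: \<zeta>_def exp_add exp_double)
  then have slog: "slog (- (y\<^sup>2)) = \<zeta>" using slog_exp[OF \<zeta>s] by simp
  have \<zeta>2: "0 < Im \<zeta>" "Im \<zeta> < 2 * pi" using \<zeta>s by (auto simp: strip_def)
  define l where "l = Leta u"
  define E where "E = eta \<mu> (exp u)"
  have E: "exp l = E" unfolding l_def E_def by (rule exp_Leta[OF nd u])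
  \<comment> \<open>\<open>Im l\<close> lies between \<open>Im \<zeta>\<close> and pi, two numbers
    at distance less than pi; the subtracted quantity is their midpoint.\<close>
  have bd: "\<bar>Im l - Im \<zeta> / 2 - pi / 2\<bar> \<le> pi / 2"
  proof (cases "Im \<zeta> \<le> pi")
    case True
    then have "Im \<zeta> \<le> Im l" "Im l \<le> pi"
      using Im_solution(3)[OF nd t u eq] by (auto simp: slog l_def)
    then show ?thesis using \<zeta>2 unfolding abs_le_iff by linarith
  next
    case False
    then have "pi \<le> Im l" "Im l \<le> Im \<zeta>"
      using Im_solution(4)[OF nd t u eq] by (auto simp: slog l_def)
    then show ?thesis using \<zeta>2 unfolding abs_le_iff by linarith
  qed
  have "y = exp (\<zeta> / 2 - \<i> * of_real pi / 2)"
    using y0 by (simp add: \<zeta>_def add_divide_distrib)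
  moreover have "- E = exp (l - \<i> * of_real pi)" by (simp add: exp_diff E)
  ultimately have "- E / y = exp (l - \<i> * of_real pi - (\<zeta> / 2 - \<i> * of_real pi / 2))"
    by (simp only: exp_diff[of "l - \<i> * of_real pi" "\<zeta> / 2 - \<i> * of_real pi / 2"])
  moreover have "Im (l - \<i> * of_real pi - (\<zeta> / 2 - \<i> * of_real pi / 2)) = Im l - Im \<zeta> / 2 - pi / 2"
    by (simp add: field_simps)
  ultimately have "Re (- E / y) \<ge> 0"
    using cos_ge_zero[of "Im l - Im \<zeta> / 2 - pi / 2"] bd by (simp only: Re_exp abs_le_iff) simp
  moreover have "Re (1 / y) > 0" using y by (simp add: Re_divide sum_power2_gt_zero_iff)
  ultimately have q: "Re ((1 - E) / y) \<ge> 0" by (simp add: diff_divide_distrib)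
  have K0: "Kint (exp u) \<noteq> 0" by (rule K_nonzero[OF nd exp_in_slit[OF u]])
  have "1 - E = 1 / Kint (exp u)"
    unfolding E_def eta_eq_1_minus_inverse[OF nd exp_in_slit[OF u]] by simp
  then have "y * Kint (exp u) = inverse ((1 - E) / y)" using K0 y0 by simp
  moreover have "Re (inverse w) \<ge> 0" if "Re w \<ge> 0" for w using that by simp
  ultimately show ?thesis using q by metis
qed

end

lemma prob_on_nonneg_iff: "prob_on_nonneg \<mu> \<longleftrightarrow> nonneg_distribution \<mu>"
  by (auto simp: prob_on_nonneg_def nonneg_distribution_def nonneg_distribution_axioms_def)

section \<open>Stieltjes transforms\<close>

lemma Poisson_kernel_denominator_pos:
  fixes w c :: real
  assumes "\<bar>w\<bar> < 1" "\<bar>c\<bar> \<le> 1"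
  shows "(1 - \<bar>w\<bar>)\<^sup>2 \<le> 1 - 2 * w * c + w\<^sup>2" "0 < 1 - 2 * w * c + w\<^sup>2"
proof -
  have "w * c \<le> \<bar>w\<bar> * \<bar>c\<bar>" by (simp add: abs_mult[symmetric])
  also have "\<dots> \<le> \<bar>w\<bar>" using assms by (simp add: mult_left_le)
  finally show le: "(1 - \<bar>w\<bar>)\<^sup>2 \<le> 1 - 2 * w * c + w\<^sup>2"
    by (simp add: power2_diff)
  have "0 < (1 - \<bar>w\<bar>)\<^sup>2" using assms by simp
  then show "0 < 1 - 2 * w * c + w\<^sup>2" using le by linarith
qed

text \<open>Cauchy's formula at \<open>w\<close>, applied to f(u) (1 - w^2) / (1 - w u) in place of
  f: the value at \<open>w\<close> is unchanged, and on the circle the extra factor turns the Cauchy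
  kernel into the Poisson kernel.\<close>

lemma Poisson_integral_real_axis:
  fixes w :: real
  assumes hol: "f holomorphic_on cball 0 1" and w: "\<bar>w\<bar> < 1"
  shows "((\<lambda>\<theta>. f (cis \<theta>) * of_real ((1 - w\<^sup>2) / (1 - 2 * w * cos \<theta> + w\<^sup>2)))
    has_integral of_real (2 * pi) * f (of_real w)) {0..2 * pi}"
proof -
  define g where "g = (\<lambda>u. f u * of_real (1 - w\<^sup>2) / (1 - of_real w * u))"
  have nz: "1 - of_real w * u \<noteq> 0" if "cmod u \<le> 1" for u
  proof
    assume "1 - of_real w * u = 0"
    then have "cmod (of_real w * u) = 1" by (metis eq_iff_diff_eq_0 norm_one)
    moreover have "\<bar>w\<bar> * cmod u \<le> \<bar>w\<bar>" using that by (simp add: mult_left_le)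
    ultimately show False using w by (simp add: norm_mult)
  qed
  have "g holomorphic_on cball 0 1"
    unfolding g_def using nz by (intro holomorphic_intros hol) auto
  then have "((\<lambda>u. g u / (u - of_real w)) has_contour_integral (2 * of_real pi * \<i> * g (of_real w))) (circlepath 0 1)"
    by (rule Cauchy_integral_circlepath_simple) (use w in simp)
  then have "((\<lambda>t. g (cis t) / (cis t - of_real w) * \<i> * cis t) has_integral (2 * of_real pi * \<i> * g (of_real w))) {0..2 * pi}"
    unfolding circlepath_def by (subst (asm) has_contour_integral_part_circlepath_iff) simp_all
  then have "((\<lambda>t. - \<i> * (g (cis t) / (cis t - of_real w) * \<i> * cis t)) has_integral - \<i> * (2 * of_real pi * \<i> * g (of_real w))) {0..2 * pi}"
    by (rule has_integral_mult_right)
  moreover have "- \<i> * (2 * of_real pi * \<i> * g (of_real w)) = of_real (2 * pi) * f (of_real w)"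
  proof -
    have "1 - w * w > 0" using w by (simp add: abs_square_less_1[unfolded power2_eq_square])
    then have "1 - complex_of_real w * of_real w \<noteq> 0"
      by (metis less_irrefl of_real_1 of_real_diff of_real_eq_0_iff of_real_mult)
    then have "g (of_real w) = f (of_real w)" by (simp add: g_def power2_eq_square)
    then show ?thesis by (simp add: complex_eq_iff)
  qed
  moreover have "- \<i> * (g (cis t) / (cis t - of_real w) * \<i> * cis t)
      = f (cis t) * of_real ((1 - w\<^sup>2) / (1 - 2 * w * cos t + w\<^sup>2))" for t
  proof -
    define d where "d = 1 - 2 * w * cos t + w\<^sup>2"
    have d: "d > 0" unfolding d_def by (rule Poisson_kernel_denominator_pos(2)[OF w]) simp
    have "(cis t)\<^sup>2 + 1 = 2 * of_real (cos t) * cis t"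
      by (rule complex_eqI) (simp_all add: Re_power2 Im_power2 sin_squared_eq power2_eq_square algebra_simps)
    moreover have "complex_of_real d = 1 - 2 * of_real w * of_real (cos t) + (of_real w)\<^sup>2"
      by (simp add: d_def)
    ultimately have "(1 - of_real w * cis t) * (cis t - of_real w) = cis t * of_real d"
      by algebra
    then have "g (cis t) / (cis t - of_real w) = f (cis t) * of_real (1 - w\<^sup>2) / (cis t * of_real d)"
      unfolding g_def by simp
    moreover have "\<i> * (X * \<i>) = - X" for X by (simp add: complex_eq_iff)
    ultimately show ?thesis using d by (simp add: d_def[symmetric])
  qed
  ultimately show ?thesis by (simp only:)
qed

text \<open>The Herglotz measure of \<open>P\<close> on the circle of radius \<open>r\<close>, pushed forward by \<open>cos\<close>: at real
  points the Poisson kernel depends on \<open>cos \<theta>\<close> only.\<close>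

lemma circle_distribution:
  assumes hol: "P holomorphic_on ball 0 1" and pos: "\<And>w. cmod w < 1 \<Longrightarrow> 0 \<le> Re (P w)"
    and P0: "0 < Re (P 0)" and r: "0 \<le> r" "r < 1"
  shows "\<exists>M. real_distribution M \<and> (AE c in M. c \<in> {-1..1}) \<and>
    (\<forall>w. \<bar>w\<bar> < 1 \<longrightarrow> (LINT c|M. (1 - w\<^sup>2) / (1 - 2 * w * c + w\<^sup>2)) = Re (P (of_real (r * w))) / Re (P 0))"
proof -
  define f where "f = (\<lambda>u. P (of_real r * u))"
  have rb: "of_real r * u \<in> ball 0 1" if "cmod u \<le> 1" for u
  proof -
    have "r * cmod u \<le> r" using that r by (simp add: mult_left_le)
    then show ?thesis using r by (simp add: norm_mult)
  qed
  have "(P \<circ> (\<lambda>u. of_real r * u)) holomorphic_on cball 0 1"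
    by (rule holomorphic_on_compose_gen[OF _ hol]) (use rb in \<open>auto intro!: holomorphic_intros\<close>)
  then have fhol: "f holomorphic_on cball 0 1" by (simp add: f_def o_def)
  \<comment> \<open>The constant makes \<open>p\<close> a probability density: at w = 0 the kernel
    is 1, and the Poisson formula is the mean value property.\<close>
  define p where "p = (\<lambda>\<theta>. Re (f (cis \<theta>)) / (2 * pi * Re (P 0)))"
  have p0: "0 \<le> p \<theta>" for \<theta>
    unfolding p_def f_def using pos[of "of_real r * cis \<theta>"] rb[of "cis \<theta>"] P0 by simp
  have contp: "continuous_on {0..2 * pi} p"
  proof -
    have "continuous_on (cball 0 1) f" using fhol by (rule holomorphic_on_imp_continuous_on)
    then have "continuous_on {0..2 * pi} (\<lambda>\<theta>. f (cis \<theta>))"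
      by (rule continuous_on_compose2) (auto intro!: continuous_intros)
    then show ?thesis unfolding p_def using P0 by (intro continuous_intros) auto
  qed
  define k where "k = (\<lambda>w c::real. (1 - w\<^sup>2) / (1 - 2 * w * c + w\<^sup>2))"
  have hk: "((\<lambda>\<theta>. p \<theta> * k w (cos \<theta>)) has_integral Re (P (of_real (r * w))) / Re (P 0)) {0..2 * pi}"
    if "\<bar>w\<bar> < 1" for w
  proof -
    have "((\<lambda>\<theta>. Re (f (cis \<theta>) * of_real (k w (cos \<theta>)))) has_integral Re (of_real (2 * pi) * f (of_real w))) {0..2 * pi}"
      unfolding k_def by (rule has_integral_Re[OF Poisson_integral_real_axis[OF fhol that]])
    then have "((\<lambda>\<theta>. Re (f (cis \<theta>) * of_real (k w (cos \<theta>))) * (1 / (2 * pi * Re (P 0)))) has_integral Re (of_real (2 * pi) * f (of_real w)) * (1 / (2 * pi * Re (P 0)))) {0..2 * pi}"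
      by (rule has_integral_mult_left)
    moreover have "Re (of_real (2 * pi) * f (of_real w)) * (1 / (2 * pi * Re (P 0))) = Re (P (of_real (r * w))) / Re (P 0)"
      using P0 by (simp add: f_def)
    moreover have "Re (f (cis \<theta>) * of_real (k w (cos \<theta>))) * (1 / (2 * pi * Re (P 0))) = p \<theta> * k w (cos \<theta>)" for \<theta>
      by (simp add: p_def)
    ultimately show ?thesis by (simp only:)
  qed
  have contk: "continuous_on {0..2 * pi} (\<lambda>\<theta>. k w (cos \<theta>))" if "\<bar>w\<bar> < 1" for w
    unfolding k_def
  proof (intro continuous_intros ballI)
    fix \<theta> :: real
    have "0 < 1 - 2 * w * cos \<theta> + w\<^sup>2" by (rule Poisson_kernel_denominator_pos(2)[OF that]) simp
    then show "1 - 2 * w * cos \<theta> + w\<^sup>2 \<noteq> 0" by simp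
  qed
  have LB: "set_integrable lborel {0..2 * pi} h \<and> (LINT \<theta>:{0..2 * pi}|lborel. h \<theta>) = integral {0..2 * pi} h"
    if "continuous_on {0..2 * pi} h" for h :: "real \<Rightarrow> real"
    using borel_integrable_atLeastAtMost'[OF that] set_borel_integral_eq_integral(2) by blast
  define q where "q = (\<lambda>\<theta>. indicator {0..2 * pi} \<theta> * p \<theta>)"
  have qint: "integrable lborel q"
    using LB[OF contp] by (simp add: q_def set_integrable_def)
  then have [measurable]: "q \<in> borel_measurable borel" by simp
  have q0: "0 \<le> q \<theta>" for \<theta> using p0 by (simp add: q_def)
  have q1: "integral\<^sup>L lborel q = 1"
  proof -
    have "integral\<^sup>L lborel q = integral {0..2 * pi} p"
      using conjunct2[OF LB[OF contp]] by (simp add: q_def set_lebesgue_integral_def)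
    also have "\<dots> = 1"
      using hk[of 0] P0 by (intro integral_unique) (simp add: k_def)
    finally show ?thesis .
  qed
  define D where "D = density lborel (\<lambda>\<theta>. ennreal (q \<theta>))"
  define M where "M = distr D borel cos"
  have "prob_space D"
  proof
    have "emeasure D (space D) = (\<integral>\<^sup>+ \<theta>. ennreal (q \<theta>) \<partial>lborel)"
      by (simp add: D_def emeasure_density)
    also have "\<dots> = 1" using nn_integral_eq_integral[OF qint] q0 q1 by simp
    finally show "emeasure D (space D) = 1" .
  qed
  moreover have cosm: "cos \<in> measurable D borel" by (simp add: D_def)
  ultimately have "prob_space M" unfolding M_def by (rule prob_space.prob_space_distr)
  then have "real_distribution M"
    by (simp add: real_distribution_def real_distribution_axioms_def M_def)
  moreover have "AE c in M. c \<in> {-1..1}"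
    unfolding M_def using cosm by (subst AE_distr_iff) auto
  moreover have "(LINT c|M. k w c) = Re (P (of_real (r * w))) / Re (P 0)" if "\<bar>w\<bar> < 1" for w
  proof -
    have km: "k w \<in> borel_measurable borel" unfolding k_def by measurable
    then have "(LINT c|M. k w c) = (LINT \<theta>|D. k w (cos \<theta>))"
      unfolding M_def by (intro integral_distr cosm)
    also have "\<dots> = (LINT \<theta>|lborel. q \<theta> *\<^sub>R k w (cos \<theta>))"
      unfolding D_def using km q0 by (intro integral_density) auto
    also have "\<dots> = (LINT \<theta>:{0..2 * pi}|lborel. p \<theta> * k w (cos \<theta>))"
      by (simp add: set_lebesgue_integral_def q_def mult.assoc)
    also have "\<dots> = integral {0..2 * pi} (\<lambda>\<theta>. p \<theta> * k w (cos \<theta>))"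
      using LB[OF continuous_on_mult[OF contp contk[OF that]]] by blast
    also have "\<dots> = Re (P (of_real (r * w))) / Re (P 0)"
      using hk[OF that] by (rule integral_unique)
    finally show ?thesis .
  qed
  ultimately show ?thesis unfolding k_def by blast
qed

text \<open>\<open>P\<close> may lack boundary values, so the measures from circles of radius
  tending to 1 are replaced by a weak limit. They all live on [-1, 1], hence are tight, and for
  fixed \<open>w\<close> the kernel is continuous there.\<close>

lemma Herglotz_real_axis:
  assumes hol: "P holomorphic_on ball 0 1" and pos: "\<And>w. cmod w < 1 \<Longrightarrow> 0 \<le> Re (P w)"
    and P0: "0 < Re (P 0)"
  shows "\<exists>M. real_distribution M \<and> (AE c in M. c \<in> {-1..1}) \<and>
    (\<forall>w. \<bar>w\<bar> < 1 \<longrightarrow> Re (P (of_real w)) = Re (P 0) * (LINT c|M. (1 - w\<^sup>2) / (1 - 2 * w * c + w\<^sup>2)))"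
proof -
  define r where "r = (\<lambda>n. 1 - 1 / real (n + 2))"
  have r: "0 \<le> r n" "r n < 1" for n by (auto simp: r_def field_simps)
  have "\<forall>n. \<exists>M. real_distribution M \<and> (AE c in M. c \<in> {-1..1}) \<and>
    (\<forall>w. \<bar>w\<bar> < 1 \<longrightarrow> (LINT c|M. (1 - w\<^sup>2) / (1 - 2 * w * c + w\<^sup>2)) = Re (P (of_real (r n * w))) / Re (P 0))"
    using circle_distribution[OF hol pos P0 r] by blast
  then obtain Q where Q: "\<And>n. real_distribution (Q n)" "\<And>n. AE c in Q n. c \<in> {-1..1}"
    "\<And>n w. \<bar>w\<bar> < 1 \<Longrightarrow> (LINT c|Q n. (1 - w\<^sup>2) / (1 - 2 * w * c + w\<^sup>2)) = Re (P (of_real (r n * w))) / Re (P 0)"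
    by metis
  have "tight Q"
    unfolding tight_def
  proof (intro conjI allI impI)
    fix e :: real assume "0 < e"
    \<comment> \<open>The intervals in \<open>tight\<close> are open on the left, so the left
      endpoint must lie below -1.\<close>
    have "1 - e < measure (Q n) {-2<..1}" for n
    proof -
      interpret real_distribution "Q n" by (rule Q(1))
      have "AE c in Q n. c \<in> {-2<..1}" using Q(2)[of n] by eventually_elim auto
      then have "measure (Q n) {-2<..1} = 1" using prob_eq_1[of "{-2<..1}"] by simp
      then show ?thesis using \<open>0 < e\<close> by simp
    qed
    then show "\<exists>a b. a < b \<and> (\<forall>n. 1 - e < measure (Q n) {a<..b})"
      by (intro exI[of _ "-2"] exI[of _ 1]) simp
  qed (rule Q(1))
  then obtain s M where s: "strict_mono (s :: nat \<Rightarrow> nat)" and M: "real_distribution M" "weak_conv_m (Q \<circ> id \<circ> s) M"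
    using tight_imp_convergent_subsubsequence[of Q id] by (auto simp: strict_mono_id)
  then have wc: "weak_conv_m (\<lambda>n. Q (s n)) M" by (simp add: o_def)
  interpret M: real_distribution M by fact
  have conv: "(\<lambda>n. LINT c|Q (s n). h c) \<longlonglongrightarrow> (LINT c|M. h c)"
    if "\<And>x. isCont h x" "\<And>x. norm (h x) \<le> B" for h :: "real \<Rightarrow> real" and B
    by (rule weak_conv_imp_integral_bdd_continuous_conv[OF Q(1) M(1) wc that])
  \<comment> \<open>Weak convergence tests functions that are continuous and bounded on the whole
    line, while the kernel may have a pole outside [-1, 1]; clamping the variable removes it and
    changes no integral.\<close>
  define cl where "cl = (\<lambda>c::real. max (-1) (min 1 c))"
  have cl: "\<bar>cl c\<bar> \<le> 1" for c by (auto simp: cl_def)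
  have cl_id: "cl c = c" if "c \<in> {-1..1}" for c using that by (auto simp: cl_def)
  have clcont: "isCont cl x" for x unfolding cl_def by (intro continuous_intros)
  have [measurable]: "cl \<in> borel_measurable borel" unfolding cl_def by measurable
  have AEM: "AE c in M. c \<in> {-1..1}"
  proof -
    \<comment> \<open>Bounded, continuous, and zero exactly on [-1, 1]: its vanishing integral in
      the limit confines \<open>M\<close> to that interval.\<close>
    define h where "h = (\<lambda>c. min 1 \<bar>c - cl c\<bar>)"
    have [measurable]: "h \<in> borel_measurable borel" unfolding h_def by measurable
    have hc: "isCont h x" for x unfolding h_def by (intro continuous_intros clcont)
    have hb: "norm (h x) \<le> 1" for x by (auto simp: h_def)
    have "(LINT c|Q (s n). h c) = (LINT c|Q (s n). 0)" for n
    proof (rule integral_cong_AE)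
      interpret Q: real_distribution "Q (s n)" by (rule Q(1))
      show "h \<in> borel_measurable (Q (s n))" by measurable
      show "AE c in Q (s n). h c = 0"
        using Q(2)[of "s n"] by eventually_elim (simp add: h_def cl_id)
    qed simp
    then have "(LINT c|M. h c) = 0"
      using conv[OF hc hb] by (simp add: LIMSEQ_const_iff)
    moreover have "integrable M h"
      by (rule M.integrable_const_bound[where B=1]) (use hb in auto)
    ultimately have "AE c in M. h c = 0"
      by (subst (asm) integral_nonneg_eq_0_iff_AE) (auto simp: h_def)
    then show ?thesis by eventually_elim (auto simp: h_def cl_def split: if_splits)
  qed
  have "Re (P (of_real w)) = Re (P 0) * (LINT c|M. (1 - w\<^sup>2) / (1 - 2 * w * c + w\<^sup>2))"
    if w: "\<bar>w\<bar> < 1" for w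
  proof -
    define k where "k = (\<lambda>c::real. (1 - w\<^sup>2) / (1 - 2 * w * c + w\<^sup>2))"
    have [measurable]: "k \<in> borel_measurable borel" unfolding k_def by measurable
    have den: "(1 - \<bar>w\<bar>)\<^sup>2 \<le> 1 - 2 * w * cl x + w\<^sup>2" "0 < 1 - 2 * w * cl x + w\<^sup>2" for x
      using Poisson_kernel_denominator_pos[OF w cl] by auto
    have w2: "0 < 1 - w\<^sup>2" using w by (simp add: abs_square_less_1)
    have kc: "isCont (\<lambda>c. k (cl c)) x" for x
      unfolding k_def using den(2)[of x] by (intro continuous_intros clcont) auto
    have kb: "norm (k (cl x)) \<le> (1 - w\<^sup>2) / (1 - \<bar>w\<bar>)\<^sup>2" for x
    proof -
      have "0 < (1 - \<bar>w\<bar>)\<^sup>2" using w by simp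
      then show ?thesis
        unfolding k_def using den[of x] w2 by (simp add: frac_le)
    qed
    have eq: "(LINT c|N. k (cl c)) = (LINT c|N. k c)"
      if "real_distribution N" "AE c in N. c \<in> {-1..1}" for N
    proof (rule integral_cong_AE)
      interpret N: real_distribution N by fact
      show "(\<lambda>c. k (cl c)) \<in> borel_measurable N" "k \<in> borel_measurable N" by measurable
      show "AE c in N. k (cl c) = k c" using that(2) by eventually_elim (simp add: cl_id)
    qed
    have "(\<lambda>n. LINT c|Q (s n). k (cl c)) \<longlonglongrightarrow> (LINT c|M. k (cl c))" by (rule conv[OF kc kb])
    then have lim1: "(\<lambda>n. Re (P (of_real (r (s n) * w))) / Re (P 0)) \<longlonglongrightarrow> (LINT c|M. k c)"
      using eq[OF Q(1,2)] eq[OF M(1) AEM] Q(3)[OF w] by (simp add: k_def)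
    have "r \<longlonglongrightarrow> 1" unfolding r_def by real_asymp
    then have "(\<lambda>n. r (s n)) \<longlonglongrightarrow> 1" using s by (rule LIMSEQ_subseq_LIMSEQ[unfolded o_def])
    then have "(\<lambda>n. complex_of_real (r (s n) * w)) \<longlonglongrightarrow> of_real w"
      by (auto intro!: tendsto_eq_intros)
    moreover have "isCont P (of_real w)"
      using holomorphic_on_imp_continuous_on[OF hol] w by (simp add: continuous_on_eq_continuous_at)
    ultimately have "(\<lambda>n. P (of_real (r (s n) * w))) \<longlonglongrightarrow> P (of_real w)"
      by (rule isCont_tendsto_compose[rotated])
    then have "(\<lambda>n. Re (P (of_real (r (s n) * w))) / Re (P 0)) \<longlonglongrightarrow> Re (P (of_real w)) / Re (P 0)"
      using P0 by (intro tendsto_intros) auto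
    with lim1 have "(LINT c|M. k c) = Re (P (of_real w)) / Re (P 0)" using LIMSEQ_unique by blast
    then show ?thesis using P0 by (simp add: k_def)
  qed
  then show ?thesis using M(1) AEM by blast
qed

text \<open>With \<open>w = (1 - y) / (1 + y)\<close> and \<open>s = (1 + c) / (1 - c)\<close>, the Poisson kernel at \<open>w\<close> equals
  \<open>(1 + s) y / (1 + s y\<^sup>2)\<close>. The limit \<open>k(0-) = 1\<close> excludes an atom at \<open>c = 1\<close>, that is at
  \<open>s = \<infinity>\<close>, and gives the total mass.\<close>

lemma Stieltjes_real_axis:
  assumes hol: "k holomorphic_on slit"
    and pos: "\<And>y. Re y > 0 \<Longrightarrow> 0 \<le> Re (y * k (- (y\<^sup>2)))"
    and k1: "0 < Re (k (- 1))"
    and lim: "((\<lambda>x. Re (k (of_real x))) \<longlongrightarrow> 1) (at_left 0)"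
  shows "\<exists>\<nu>. prob_on_nonneg \<nu> \<and> (\<forall>x<0. Re (k (of_real x)) = (LINT s|\<nu>. 1 / (1 - x * s)))"
proof -
  define Y where "Y = (\<lambda>w::complex. (1 - w) / (1 + w))"
  define P where "P = (\<lambda>w. Y w * k (- ((Y w)\<^sup>2)))"
  have RY: "Re (Y w) > 0" and np: "1 + w \<noteq> 0" if "cmod w < 1" for w
    using Cayley_transform_Re_pos[OF that] by (auto simp: Y_def)
  have sq: "- (y\<^sup>2) \<in> slit" if "Re y > 0" for y
    using that by (auto simp: complex_nonneg_Reals_iff Im_power2 Re_power2)
  have Yhol: "Y holomorphic_on ball 0 1"
    unfolding Y_def using np by (intro holomorphic_intros) auto
  have "(\<lambda>w. - ((Y w)\<^sup>2)) holomorphic_on ball 0 1"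
    by (intro holomorphic_intros Yhol)
  then have "(k \<circ> (\<lambda>w. - ((Y w)\<^sup>2))) holomorphic_on ball 0 1"
    by (rule holomorphic_on_compose_gen[OF _ hol]) (use sq[OF RY] in auto)
  then have Phol: "P holomorphic_on ball 0 1"
    unfolding P_def o_def by (intro holomorphic_intros Yhol)
  have Ppos: "0 \<le> Re (P w)" if "cmod w < 1" for w
    unfolding P_def by (rule pos[OF RY[OF that]])
  have P0: "Re (P 0) = Re (k (- 1))" by (simp add: P_def Y_def)
  define K0 where "K0 = Re (k (- 1))"
  obtain M where M: "real_distribution M" "AE c in M. c \<in> {-1..1}"
    "\<And>w. \<bar>w\<bar> < 1 \<Longrightarrow> Re (P (of_real w)) = K0 * (LINT c|M. (1 - w\<^sup>2) / (1 - 2 * w * c + w\<^sup>2))"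
    using Herglotz_real_axis[OF Phol Ppos] k1 unfolding P0 K0_def by blast
  interpret M: real_distribution M by fact
  have K0: "0 < K0" using k1 by (simp add: K0_def)
  \<comment> \<open>\<open>K0\<close> times the Poisson kernel at w = (1 - y) / (1 + y), divided by
    y. Its limit 2 K0 / (1 - c) as y tends to 0 is the density \<open>u\<close> below.\<close>
  define h where "h = (\<lambda>y c::real. 2 * K0 / ((1 - c) + (1 + c) * y\<^sup>2))"
  have hden: "0 < (1 - c) + (1 + c) * y\<^sup>2" if "0 < y" "c \<in> {-1..1}" for y c :: real
    using that by (cases "c = 1") (auto intro: add_pos_nonneg)
  have hm [measurable]: "h y \<in> borel_measurable borel" for y unfolding h_def by measurable
  have hint: "integrable M (h y)" if y: "0 < y" for y
  proof (rule M.integrable_const_bound)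
    show "AE c in M. norm (h y c) \<le> 2 * K0 / min 1 (y\<^sup>2)"
      using M(2)
    proof eventually_elim
      case (elim c)
      define m where "m = min 1 (y\<^sup>2)"
      have m: "0 < m" "m \<le> 1" "m \<le> y\<^sup>2" using y by (auto simp: m_def)
      have "m * (1 - c) + m * (1 + c) \<le> 1 * (1 - c) + y\<^sup>2 * (1 + c)"
        using elim m by (intro add_mono mult_right_mono) auto
      then have "2 * m \<le> (1 - c) + (1 + c) * y\<^sup>2" by (simp add: algebra_simps)
      then have "min 1 (y\<^sup>2) \<le> (1 - c) + (1 + c) * y\<^sup>2" using m(1) unfolding m_def by linarith
      moreover have "0 < min 1 (y\<^sup>2)" using y by simp
      ultimately show ?case using K0 hden[OF y elim] unfolding h_def
        by (simp add: frac_le)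
    qed
  qed measurable
  have keq: "Re (k (of_real (- (y\<^sup>2)))) = (LINT c|M. h y c)" if y: "0 < y" for y
  proof -
    define w where "w = (1 - y) / (1 + y)"
    have w: "\<bar>w\<bar> < 1" using y by (simp add: w_def abs_if field_simps)
    have "Y (of_real w) = of_real ((1 - w) / (1 + w))" by (simp add: Y_def)
    also have "(1 - w) / (1 + w) = y" using y by (simp add: w_def field_simps)
    finally have "Re (P (of_real w)) = y * Re (k (of_real (- (y\<^sup>2))))"
      by (simp add: P_def)
    then have "y * Re (k (of_real (- (y\<^sup>2)))) = K0 * (LINT c|M. (1 - w\<^sup>2) / (1 - 2 * w * c + w\<^sup>2))"
      using M(3)[OF w] by simp
    also have "(LINT c|M. (1 - w\<^sup>2) / (1 - 2 * w * c + w\<^sup>2)) = (LINT c|M. y / K0 * h y c)"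
    proof (rule integral_cong_AE)
      show "AE c in M. (1 - w\<^sup>2) / (1 - 2 * w * c + w\<^sup>2) = y / K0 * h y c"
        using M(2)
      proof eventually_elim
        case (elim c)
        have "(1 - w\<^sup>2) * (1 + y)\<^sup>2 = 4 * y"
          using y by (simp add: w_def power_divide left_diff_distrib) (simp add: power2_eq_square algebra_simps)
        moreover have "(1 - 2 * w * c + w\<^sup>2) * (1 + y)\<^sup>2 = 2 * ((1 - c) + (1 + c) * y\<^sup>2)"
        proof -
          have wy: "w * (1 + y) = 1 - y" using y by (simp add: w_def)
          have "(1 - 2 * w * c + w\<^sup>2) * (1 + y)\<^sup>2
              = (1 + y)\<^sup>2 - 2 * c * (w * (1 + y)) * (1 + y) + (w * (1 + y))\<^sup>2"
            by (simp add: power2_eq_square algebra_simps)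
          then show ?thesis unfolding wy by (simp add: power2_eq_square algebra_simps)
        qed
        ultimately have eq: "(1 - w\<^sup>2) / (1 - 2 * w * c + w\<^sup>2) = 4 * y / (2 * ((1 - c) + (1 + c) * y\<^sup>2))"
          using y by (metis less_numeral_extra(1) add_pos_pos less_irrefl mult_divide_mult_cancel_right power_not_zero)
        have aux: "4 * y / (2 * d) = y / K0 * (2 * K0 / d)" for d using K0 by simp
        show ?case unfolding h_def eq by (rule aux)
      qed
    qed measurable
    also have "K0 * (LINT c|M. y / K0 * h y c) = y * (LINT c|M. h y c)"
      using K0 by simp
    finally show ?thesis using y by simp
  qed
  define e where "e = (\<lambda>n. 1 / real (Suc n))"
  have e: "0 < e n" for n by (simp add: e_def)
  have e0: "e \<longlonglongrightarrow> 0" unfolding e_def by (rule LIMSEQ_Suc[OF lim_1_over_n])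
  have elim0: "(\<lambda>n. LINT c|M. h (e n) c) \<longlonglongrightarrow> 1"
  proof -
    have "filterlim (\<lambda>n. - ((e n)\<^sup>2)) (at_left 0) sequentially"
      unfolding filterlim_at using e[THEN less_imp_neq] by (auto intro!: tendsto_eq_intros e0)
    then have "(\<lambda>n. Re (k (of_real (- ((e n)\<^sup>2))))) \<longlonglongrightarrow> 1"
      by (rule filterlim_compose[OF lim])
    then show ?thesis using keq[OF e] by simp
  qed
  \<comment> \<open>At c = 1 the integrand is K0 / y^2, while the integrals converge to 1 as y tends
    to 0; mass at 1 would make them blow up.\<close>
  have atom: "measure M {1} = 0"
  proof -
    have le: "measure M {1} \<le> (e n)\<^sup>2 / K0 * (LINT c|M. h (e n) c)" for n
    proof -
      have "(LINT c|M. K0 / (e n)\<^sup>2 * indicator {1} c) \<le> (LINT c|M. h (e n) c)"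
      proof (rule integral_mono_AE)
        show "AE c in M. K0 / (e n)\<^sup>2 * indicator {1} c \<le> h (e n) c"
          using M(2)
        proof eventually_elim
          case (elim c)
          then show ?case using hden[OF e elim, of n] K0 by (auto simp: h_def indicator_def)
        qed
        show "integrable M (\<lambda>c. K0 / (e n)\<^sup>2 * indicator {1} c)"
          by (intro integrable_mult_right integrable_real_indicator) (auto simp: M.emeasure_eq_measure)
      qed (rule hint[OF e])
      then have "K0 / (e n)\<^sup>2 * measure M {1} \<le> (LINT c|M. h (e n) c)" by simp
      then show ?thesis using K0 e[of n] by (simp add: field_simps)
    qed
    have "(\<lambda>n. (e n)\<^sup>2 / K0 * (LINT c|M. h (e n) c)) \<longlonglongrightarrow> 0"
      using K0 by (auto intro!: tendsto_eq_intros e0 elim0)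
    then have "measure M {1} \<le> 0"
      by (rule LIMSEQ_le_const) (use le in auto)
    then show ?thesis by (simp add: measure_le_0_iff)
  qed
  have AE1: "AE c in M. c \<in> {-1..<1}"
  proof -
    have "AE c in M. c \<notin> {1}"
      using atom by (intro AE_not_in) (simp add: null_sets_def M.emeasure_eq_measure)
    with M(2) show ?thesis by eventually_elim auto
  qed
  define u where "u = (\<lambda>c::real. if c < 1 then 2 * K0 / (1 - c) else 0)"
  have [measurable]: "u \<in> borel_measurable borel" unfolding u_def by measurable
  have u0: "0 \<le> u c" for c using K0 by (simp add: u_def)
  \<comment> \<open>As y decreases to 0, \<open>h y\<close> increases to \<open>u\<close> off c = 1.
    Monotone convergence makes the integral of \<open>u\<close> the limit of k at 0-, that is
    1.\<close>
  have uint: "integrable M u" and u1: "integral\<^sup>L M u = 1"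
  proof -
    have m: "AE c in M. mono (\<lambda>n. h (e n) c)"
      using AE1
    proof eventually_elim
      case (elim c)
      show ?case
      proof (rule monoI)
        fix i j :: nat assume "i \<le> j"
        then have "e j \<le> e i" by (simp add: e_def field_simps)
        then have "(e j)\<^sup>2 \<le> (e i)\<^sup>2" using e[of j] by (intro power_mono) auto
        then have "(1 - c) + (1 + c) * (e j)\<^sup>2 \<le> (1 - c) + (1 + c) * (e i)\<^sup>2"
          using elim by (intro add_left_mono mult_left_mono) auto
        then show "h (e i) c \<le> h (e j) c"
          unfolding h_def using K0 hden[OF e, of c] elim by (intro divide_left_mono mult_pos_pos) auto
      qed
    qed
    have p: "AE c in M. 0 \<le> h (e n) c" for n
      using M(2)
    proof eventually_elim
      case (elim c)
      then show ?case unfolding h_def using K0 hden[OF e elim, of n] by simp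
    qed
    have l: "AE c in M. (\<lambda>n. h (e n) c) \<longlonglongrightarrow> u c"
      using AE1
    proof eventually_elim
      case (elim c)
      then show ?case unfolding h_def u_def by (auto intro!: tendsto_eq_intros e0)
    qed
    show "integrable M u" "integral\<^sup>L M u = 1"
      using integral_monotone_convergence_nonneg[OF hint[OF e] m p l elim0] by auto
  qed
  define S where "S = (\<lambda>c::real. (1 + c) / (1 - c))"
  have [measurable]: "S \<in> borel_measurable borel" unfolding S_def by measurable
  define D where "D = density M (\<lambda>c. ennreal (u c))"
  define \<nu> where "\<nu> = distr D borel S"
  have "prob_space D"
  proof
    have "emeasure D (space D) = (\<integral>\<^sup>+ c. ennreal (u c) \<partial>M)"
      by (simp add: D_def emeasure_density)
    also have "\<dots> = 1" using nn_integral_eq_integral[OF uint] u0 u1 by simp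
    finally show "emeasure D (space D) = 1" .
  qed
  moreover have Sm: "S \<in> measurable D borel" by (simp add: D_def)
  ultimately have "prob_space \<nu>" unfolding \<nu>_def by (rule prob_space.prob_space_distr)
  then have "real_distribution \<nu>"
    by (simp add: real_distribution_def real_distribution_axioms_def \<nu>_def)
  moreover have "emeasure \<nu> {..<0} = 0"
  proof -
    have "AE c in M. \<not> S c < 0"
      using AE1 by eventually_elim (auto simp: S_def divide_less_0_iff)
    then have "AE c in D. \<not> S c < 0"
      unfolding D_def by (subst AE_density) auto
    then have "AE s in \<nu>. \<not> s < 0"
      unfolding \<nu>_def using Sm by (subst AE_distr_iff) auto
    then show ?thesis
      by (subst (asm) AE_iff_measurable[of "{..<0}"]) (auto simp: \<nu>_def)
  qed
  ultimately have "prob_on_nonneg \<nu>" by (simp add: prob_on_nonneg_def)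
  moreover have "Re (k (of_real x)) = (LINT s|\<nu>. 1 / (1 - x * s))" if x: "x < 0" for x
  proof -
    define y where "y = sqrt (- x)"
    have y: "0 < y" "- (y\<^sup>2) = x" using x by (auto simp: y_def)
    have "(LINT s|\<nu>. 1 / (1 - x * s)) = (LINT c|D. 1 / (1 - x * S c))"
      unfolding \<nu>_def by (intro integral_distr Sm) measurable
    also have "\<dots> = (LINT c|M. u c *\<^sub>R (1 / (1 - x * S c)))"
      unfolding D_def using u0 by (intro integral_density) auto
    also have "\<dots> = (LINT c|M. h y c)"
    proof (rule integral_cong_AE)
      show "AE c in M. u c *\<^sub>R (1 / (1 - x * S c)) = h y c"
        using AE1
      proof eventually_elim
        case (elim c)
        \<comment> \<open>Clearing 1 - c merges the density \<open>u\<close> and the Stieltjes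
          kernel at S c into the single fraction \<open>h y c\<close>, with -x = y^2.\<close>
        have "S c * (1 - c) = 1 + c" using elim by (simp add: S_def)
        moreover have "(1 - x * S c) * (1 - c) = (1 - c) - x * (S c * (1 - c))"
          by (simp add: algebra_simps)
        ultimately have prod: "(1 - x * S c) * (1 - c) = (1 - c) + (1 + c) * y\<^sup>2"
          by (simp add: mult.commute flip: y(2))
        have uc: "u c = 2 * K0 / (1 - c)" using elim by (simp add: u_def)
        show ?case unfolding h_def uc prod[symmetric] by (simp add: mult.commute)
      qed
    qed measurable
    also have "\<dots> = Re (k (of_real x))" using keq[OF y(1)] y(2) by simp
    finally show ?thesis by simp
  qed
  ultimately show ?thesis by blast
qed

text \<open>Both functions are real on the negative axis and their real parts agree there; the
  identity theorem does the rest.\<close>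

lemma Stieltjes_slit:
  assumes hol: "k holomorphic_on slit"
    and pos: "\<And>y. Re y > 0 \<Longrightarrow> 0 \<le> Re (y * k (- (y\<^sup>2)))"
    and k1: "0 < Re (k (- 1))"
    and lim: "((\<lambda>x. Re (k (of_real x))) \<longlongrightarrow> 1) (at_left 0)"
    and real: "\<And>x. x < 0 \<Longrightarrow> Im (k (of_real x)) = 0"
  shows "\<exists>\<nu>. nonneg_distribution \<nu> \<and> (\<forall>z\<in>slit. nonneg_distribution.Kint \<nu> z = k z)"
proof -
  obtain \<nu> where \<nu>: "prob_on_nonneg \<nu>" "\<And>x. x < 0 \<Longrightarrow> Re (k (of_real x)) = (LINT s|\<nu>. 1 / (1 - x * s))"
    using Stieltjes_real_axis[OF hol pos k1 lim] by blast
  interpret nonneg_distribution \<nu> using \<nu>(1) by (simp add: prob_on_nonneg_iff)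
  have "Kint z - k z = 0" if "z \<in> slit" for z
  proof (rule analytic_continuation[of "\<lambda>z. Kint z - k z" slit neg_axis "-1"])
    show "(\<lambda>z. Kint z - k z) holomorphic_on slit"
      by (intro holomorphic_intros holomorphic_K hol)
    show "neg_axis \<subseteq> slit" using neg_in_slit by auto
    show "- 1 islimpt neg_axis"
      unfolding islimpt_approachable
    proof (intro allI impI)
      fix e :: real assume "e > 0"
      then show "\<exists>x'\<in>neg_axis. x' \<noteq> - 1 \<and> dist x' (- 1) < e"
        by (intro bexI[of _ "of_real (- 1 - e / 2)"]) (auto simp: dist_norm complex_eq_iff norm_divide)
    qed
    show "Kint z - k z = 0" if "z \<in> neg_axis" for z
    proof -
      obtain x where x: "x < 0" "z = of_real x" using \<open>z \<in> neg_axis\<close> by auto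
      have "Kint z = of_real (Re (k z))" unfolding x(2) K_of_real Kreal_def using \<nu>(2)[OF x(1)] by simp
      then show ?thesis using real[OF x(1)] by (simp add: x(2) complex_eq_iff)
    qed
  qed (use that open_slit connected_slit in \<open>auto simp: complex_nonneg_Reals_iff\<close>)
  then show ?thesis using nonneg_distribution_axioms by auto
qed

section \<open>The semigroup\<close>

theorem theorem2p17:
  fixes \<mu> :: "real measure" and t :: real
  assumes "prob_on_nonneg \<mu>" and "\<mu> \<noteq> delta0" and "t \<ge> 1"
  shows "\<exists>\<mu>t \<omega>.
    \<comment> \<open>(1)\<close>
    (prob_on_nonneg \<mu>t \<and> \<mu>t \<noteq> delta0 \<and>
      (\<forall>\<^sub>F x in at_left (0::real).
         Sigma_transform \<mu>t (complex_of_real x)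
           = Sigma_transform \<mu> (complex_of_real x) powr complex_of_real t)) \<and>
    \<comment> \<open>(2)\<close>
    (\<omega> holomorphic_on slit \<and> \<omega> ` slit \<subseteq> slit \<and> \<omega> ` neg_axis \<subseteq> neg_axis \<and>
      ((\<lambda>x. \<omega> (complex_of_real x)) \<longlongrightarrow> 0) (at_left (0::real)) \<and>
      (\<forall>z. Im z > 0 \<longrightarrow> Arg z \<le> Arg (\<omega> z) \<and> Arg (\<omega> z) < pi) \<and>
      (\<forall>z\<in>slit. eta \<mu>t z = eta \<mu> (\<omega> z))) \<and>
    \<comment> \<open>(3)\<close>
    (\<exists>g. is_power_branch (\<lambda>z. z / eta \<mu>t z) (1 / t) g \<and>
      (\<forall>z\<in>slit. \<omega> z = eta \<mu>t z * g z)) \<and>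
    \<comment> \<open>(4)\<close>
    (\<exists>h \<Phi>. is_power_branch (\<lambda>z. z / eta \<mu> z) (t - 1) h \<and>
      (\<forall>z\<in>slit. \<Phi> z = z * h z) \<and>
      \<Phi> holomorphic_on slit \<and> \<Phi> ` slit \<subseteq> - {0} \<and>
      (\<forall>z\<in>slit. \<Phi> (\<omega> z) = z))"
proof -
  interpret nonneg_distribution \<mu> using assms(1) by (simp add: prob_on_nonneg_iff)
  note nd = assms(2) and t = assms(3)
  have Lin: "Leta ` strip \<subseteq> strip" using Leta_in_strip[OF nd] by blast
  obtain W where W: "W holomorphic_on strip" "\<And>\<zeta>. \<zeta> \<in> strip \<Longrightarrow> W \<zeta> \<in> strip"
    "\<And>\<zeta>. \<zeta> \<in> strip \<Longrightarrow> of_real t * W \<zeta> - of_real (t - 1) * Leta (W \<zeta>) = \<zeta>"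
    using strip_equation_inverse[OF holomorphic_Leta[OF nd] Lin t] by blast
  \<comment> \<open>A holomorphic logarithm of \<open>\<omega>\<close>.\<close>
  define V where "V = (\<lambda>z. W (slog z))"
  define \<omega> where "\<omega> = (\<lambda>z. exp (V z))"
  have V: "V z \<in> strip" "of_real t * V z - of_real (t - 1) * Leta (V z) = slog z" if "z \<in> slit" for z
    using W(2,3)[OF slog_in_strip[OF that]] by (auto simp: V_def)
  have "(W \<circ> slog) holomorphic_on slit"
    by (rule holomorphic_on_compose_gen[OF holomorphic_slog W(1)]) (use slog_in_strip in auto)
  then have Vhol: "V holomorphic_on slit" by (simp add: V_def o_def)
  then have \<omega>hol: "\<omega> holomorphic_on slit" unfolding \<omega>_def by (intro holomorphic_intros)
  have \<omega>in: "\<omega> z \<in> slit" if "z \<in> slit" for z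
    unfolding \<omega>_def by (rule exp_in_slit[OF V(1)[OF that]])
  have eta\<omega>: "eta \<mu> (\<omega> z) = exp (Leta (V z))" if "z \<in> slit" for z
    unfolding \<omega>_def using exp_Leta[OF nd V(1)[OF that]] by simp

  define A where "A = (\<lambda>x::real. Re (V (of_real x)))"
  have VA: "V (of_real x) = of_real (A x) + \<i> * of_real pi" if "x < 0" for x
  proof -
    have "Im (slog (of_real x)) = pi" using that by (simp add: slog_neg)
    then have "Im (V (of_real x)) = pi"
      using Im_solution(1)[OF nd t V[OF neg_in_slit[OF that]]] by simp
    then show ?thesis by (simp add: A_def complex_eq_iff)
  qed
  have \<omega>neg: "\<omega> (of_real x) = of_real (- exp (A x))" if "x < 0" for x
    unfolding \<omega>_def VA[OF that] by (rule exp_midline)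
  define l where "l = (\<lambda>x::real. Re (Leta (V (of_real x))))"
  have ImL: "Im (Leta (V (of_real x))) = pi" if "x < 0" for x
    by (rule Im_Leta_midline[OF nd]) (simp add: VA[OF that])
  have Al: "t * A x - (t - 1) * l x = ln (- x)" if "x < 0" for x
    using V(2)[OF neg_in_slit[OF that], THEN arg_cong[where f=Re]] that
    by (simp add: A_def l_def slog_neg)
  \<comment> \<open>For e = pi the band of the growth lemma shrinks to the midline, the image of the
    negative axis.\<close>
  obtain C where C: "\<And>u. pi \<le> Im u \<and> Im u \<le> 2 * pi - pi \<Longrightarrow> \<bar>Re (Leta u)\<bar> \<le> \<bar>Re u\<bar> + C"
    using strip_self_map_linear_growth[OF holomorphic_Leta[OF nd] Lin pi_gt_zero order_refl] by blast
  \<comment> \<open>Smallness rules out A x >= 0, where t A - (t - 1) |A| would be A itself. For A x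
    < 0 that expression is (2 t - 1) A, hence the factor.\<close>
  have Abound: "(2 * t - 1) * A x \<le> ln (- x) + (t - 1) * C"
    if x: "x < 0" and small: "ln (- x) + (t - 1) * C < 0" for x
  proof -
    have "l x \<le> \<bar>A x\<bar> + C"
      using C[of "V (of_real x)"] VA[OF x] by (simp add: l_def)
    then have "(t - 1) * l x \<le> (t - 1) * (\<bar>A x\<bar> + C)" using t by (intro mult_left_mono) auto
    then have *: "t * A x - (t - 1) * \<bar>A x\<bar> \<le> ln (- x) + (t - 1) * C"
      using Al[OF x] by (simp add: algebra_simps)
    have "A x < 0"
    proof (rule ccontr)
      assume "\<not> A x < 0"
      then have "A x \<le> ln (- x) + (t - 1) * C" using * by (simp add: algebra_simps)
      then show False using \<open>\<not> A x < 0\<close> small by linarith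
    qed
    then show ?thesis using * by (simp add: algebra_simps)
  qed
  have expA: "((\<lambda>x. exp (A x)) \<longlongrightarrow> 0) (at_left 0)"
  proof (rule tendstoI)
    fix e :: real assume e: "0 < e"
    \<comment> \<open>The first entry secures the smallness that \<open>Abound\<close> requires, the
      second gives A x < ln e.\<close>
    define B where "B = min (- ((t - 1) * C)) ((2 * t - 1) * ln e - (t - 1) * C)"
    have "filterlim (\<lambda>x::real. ln (- x)) at_bot (at_left 0)" by real_asymp
    then have "\<forall>\<^sub>F x in at_left (0::real). ln (- x) < B" by (simp add: filterlim_at_bot_dense)
    moreover have "\<forall>\<^sub>F x in at_left (0::real). x < 0" by (simp add: eventually_at_filter)
    ultimately show "\<forall>\<^sub>F x in at_left 0. dist (exp (A x)) 0 < e"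
    proof eventually_elim
      case (elim x)
      have "(2 * t - 1) * A x \<le> ln (- x) + (t - 1) * C"
        using elim by (intro Abound) (auto simp: B_def)
      also have "\<dots> < (2 * t - 1) * ln e" using elim by (auto simp: B_def)
      finally have "A x < ln e" using t by simp
      then have "exp (A x) < e" using e by (metis exp_less_cancel_iff exp_ln)
      then show ?case by simp
    qed
  qed

  define k where "k = (\<lambda>z. Kint (\<omega> z))"
  have kneg: "k (of_real x) = of_real (Kreal (- exp (A x)))" if "x < 0" for x
    by (simp only: k_def \<omega>neg[OF that] K_of_real)
  have "\<exists>\<nu>. nonneg_distribution \<nu> \<and> (\<forall>z\<in>slit. nonneg_distribution.Kint \<nu> z = k z)"
  proof (rule Stieltjes_slit)
    have "(Kint \<circ> \<omega>) holomorphic_on slit"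
      by (rule holomorphic_on_compose_gen[OF \<omega>hol holomorphic_K]) (use \<omega>in in auto)
    then show "k holomorphic_on slit" by (simp add: k_def o_def)
    show "0 \<le> Re (y * k (- (y\<^sup>2)))" if y: "Re y > 0" for y
    proof -
      have "- (y\<^sup>2) \<in> slit"
        using y by (auto simp: complex_nonneg_Reals_iff Im_power2 Re_power2)
      then show ?thesis
        unfolding k_def \<omega>_def by (intro Re_half_plane_K[OF nd t V y])
    qed
    show "0 < Re (k (- 1))" using kneg[of "-1"] Kreal_bounds(1)[OF nd] by simp
    show "Im (k (of_real x)) = 0" if "x < 0" for x using kneg[OF that] by simp
    have "filterlim (\<lambda>x. - exp (A x)) (at_left 0) (at_left 0)"
      unfolding filterlim_at using tendsto_minus[OF expA] by auto
    then have "((\<lambda>x. Kreal (- exp (A x))) \<longlongrightarrow> 1) (at_left 0)"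
      by (rule filterlim_compose[OF Kreal_tendsto_1])
    moreover have "\<forall>\<^sub>F x in at_left (0::real). Kreal (- exp (A x)) = Re (k (of_real x))"
    proof -
      have "\<forall>\<^sub>F x in at_left (0::real). x < 0" by (simp add: eventually_at_filter)
      then show ?thesis by eventually_elim (simp add: kneg)
    qed
    ultimately show "((\<lambda>x. Re (k (of_real x))) \<longlongrightarrow> 1) (at_left 0)"
      by (rule Lim_transform_eventually)
  qed
  then obtain \<nu> where \<nu>: "nonneg_distribution \<nu>" "\<And>z. z \<in> slit \<Longrightarrow> nonneg_distribution.Kint \<nu> z = k z"
    by blast
  interpret N: nonneg_distribution \<nu> by (rule \<nu>(1))
  \<comment> \<open>The transform \<open>Kint\<close> of the point mass at 0 is constantly 1, while
    \<open>Kreal\<close> is below 1 on the negative axis.\<close>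
  have nnd: "\<nu> \<noteq> delta0"
  proof
    assume d: "\<nu> = delta0"
    have "N.Kint (- 1) = 1" unfolding N.Kint_def by (subst d, subst integral_return) simp_all
    moreover have "N.Kint (- 1) = of_real (Kreal (- exp (A (-1))))"
      using \<nu>(2)[of "-1"] kneg[of "-1"] neg_in_slit[of "-1"] by simp
    ultimately have "Kreal (- exp (A (-1))) = 1" by (metis of_real_eq_1_iff)
    then show False using Kreal_bounds(2)[OF nd, of "- exp (A (-1))"] by simp
  qed
  have eta\<nu>: "eta \<nu> z = eta \<mu> (\<omega> z)" if "z \<in> slit" for z
    unfolding N.eta_eq_1_minus_inverse[OF nnd that] eta_eq_1_minus_inverse[OF nd \<omega>in[OF that]] \<nu>(2)[OF that]
    by (simp add: k_def)

  have S: "\<forall>\<^sub>F x in at_left (0::real). Sigma_transform \<nu> (complex_of_real x)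
           = Sigma_transform \<mu> (complex_of_real x) powr complex_of_real t"
  proof -
    have "\<forall>\<^sub>F x in at_left (0::real). x \<in> {N.eta_real (-1)<..<0}"
      by (rule eventually_at_left_real) (simp add: N.eta_real_neg[OF nnd])
    then show ?thesis
    proof eventually_elim
      case (elim x)
      then have x0: "x < 0" by simp
      \<comment> \<open>With x = eta_nu(y) = eta_mu(omega(y)), the two inverses at x are y and
        omega(y). Taking logarithms, \<open>Al\<close> says that ln(y / x) is t times ln(omega(y) /
        x).\<close>
      obtain y where y: "y < 0" "N.eta_real y = x"
        using N.eta_real_surj[OF nnd, of x] elim by auto
      have ey: "eta \<nu> (of_real y) = of_real x" using N.eta_of_real[OF nnd y(1)] y(2) by simp
      then have i1: "eta_inv \<nu> (of_real x) = of_real y" using N.eta_inv_eta[OF nnd y(1)] by simp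
      have e\<mu>: "eta \<mu> (of_real (- exp (A y))) = of_real x"
        using eta\<nu>[OF neg_in_slit[OF y(1)]] ey \<omega>neg[OF y(1)] by simp
      then have i2: "eta_inv \<mu> (of_real x) = of_real (- exp (A y))"
        using eta_inv_eta[OF nd, of "- exp (A y)"] by simp
      have "Leta (V (of_real y)) = slog (of_real x)"
        unfolding Leta_def using e\<mu> \<omega>neg[OF y(1)] by (simp add: \<omega>_def)
      then have lx: "l y = ln (- x)" using x0 by (simp add: l_def slog_neg)
      have q: "y / x = exp (t * (A y - l y))"
      proof -
        have "y / x = exp (ln (- y)) / exp (ln (- x))" using y x0 by simp
        also have "\<dots> = exp (ln (- y) - ln (- x))" by (simp only: exp_diff)
        also have "ln (- y) - ln (- x) = t * (A y - l y)"
          unfolding Al[OF y(1), symmetric] lx[symmetric] by (simp add: algebra_simps)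
        finally show ?thesis .
      qed
      have p: "- exp (A y) / x = exp (A y - l y)"
        using x0 by (simp add: exp_diff lx)
      have "Sigma_transform \<nu> (of_real x) = of_real (y / x)" by (simp add: Sigma_transform_def i1)
      also have "\<dots> = of_real ((- exp (A y) / x) powr t)"
        unfolding p q powr_def by simp
      also have "\<dots> = of_real (- exp (A y) / x) powr of_real t"
        by (rule powr_of_real[symmetric]) (unfold p, simp_all)
      also have "of_real (- exp (A y) / x) = Sigma_transform \<mu> (of_real x)"
        by (simp add: Sigma_transform_def i2)
      finally show ?case .
    qed
  qed

  have \<omega>axis: "\<omega> ` neg_axis \<subseteq> neg_axis"
  proof clarify
    fix x :: real assume "x < 0"
    then show "\<omega> (of_real x) \<in> neg_axis" using \<omega>neg by (intro image_eqI[of _ _ "- exp (A x)"]) auto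
  qed
  have \<omega>lim: "((\<lambda>x. \<omega> (of_real x)) \<longlongrightarrow> 0) (at_left (0::real))"
  proof -
    have "((\<lambda>x. complex_of_real (- exp (A x))) \<longlongrightarrow> of_real (- 0)) (at_left 0)"
      by (intro tendsto_intros expA)
    moreover have "\<forall>\<^sub>F x in at_left (0::real). complex_of_real (- exp (A x)) = \<omega> (of_real x)"
    proof -
      have "\<forall>\<^sub>F x in at_left (0::real). x < 0" by (simp add: eventually_at_filter)
      then show ?thesis by eventually_elim (simp add: \<omega>neg)
    qed
    ultimately show ?thesis using Lim_transform_eventually by fastforce
  qed
  have arg: "Arg z \<le> Arg (\<omega> z) \<and> Arg (\<omega> z) < pi" if "Im z > 0" for z
  proof -
    have z: "z \<in> slit" using that by (simp add: complex_nonneg_Reals_iff)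
    have zs: "0 < Im (slog z)" using slog_in_strip[OF z] by (simp add: strip_def)
    have "Im (slog z) < pi"
    proof -
      have "Arg z < pi" using that Arg_lt_pi[of z] by blast
      then show ?thesis by (simp add: Arg_eq_Im_slog[OF that])
    qed
    then have v: "Im (slog z) \<le> Im (V z)" "Im (V z) < pi"
      using Im_solution(2)[OF nd t V[OF z]] by auto
    then have "Im (\<omega> z) > 0" using zs by (simp add: \<omega>_def Im_exp sin_gt_zero)
    then have "Arg (\<omega> z) = Im (V z)"
      using Arg_eq_Im_slog slog_exp[OF V(1)[OF z]] by (simp add: \<omega>_def)
    then show ?thesis using v Arg_eq_Im_slog[OF that] by simp
  qed

  have LVhol: "(\<lambda>z. Leta (V z)) holomorphic_on slit"
  proof -
    have "(Leta \<circ> V) holomorphic_on slit"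
      by (rule holomorphic_on_compose_gen[OF Vhol holomorphic_Leta[OF nd]]) (use V(1) in auto)
    then show ?thesis by (simp add: o_def)
  qed
  have part3: "\<exists>g. is_power_branch (\<lambda>z. z / eta \<nu> z) (1 / t) g \<and> (\<forall>z\<in>slit. \<omega> z = eta \<nu> z * g z)"
  proof (intro exI conjI ballI)
    \<comment> \<open>On the negative axis both logarithms have imaginary part pi, so
      \<open>L\<close> is real there and the branch is the positive one. The equation for
      \<open>V\<close> reads V = Leta V + L / t.\<close>
    define L where "L = (\<lambda>z. slog z - Leta (V z))"
    define g where "g = (\<lambda>z. exp (of_real (1 / t) * L z))"
    have f: "z / eta \<nu> z = exp (L z)" if "z \<in> slit" for z
      using that by (simp add: L_def exp_diff exp_slog eta\<nu> eta\<omega>)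
    have Lneg: "L (of_real x) = of_real (ln (- x) - l x)" if "x < 0" for x
      using ImL[OF that] that by (simp add: L_def l_def slog_neg complex_eq_iff)
    have gneg: "g (of_real x) = of_real (exp (1 / t * (ln (- x) - l x)))" if "x < 0" for x
      unfolding g_def Lneg[OF that] by (simp only: of_real_mult[symmetric] exp_of_real)
    show "is_power_branch (\<lambda>z. z / eta \<nu> z) (1 / t) g"
      unfolding is_power_branch_def
    proof (intro conjI exI[of _ L] ballI allI impI)
      show "L holomorphic_on slit"
        unfolding L_def by (intro holomorphic_intros holomorphic_slog LVhol)
      show "g z = exp (of_real (1 / t) * L z)" for z by (simp only: g_def)
    qed (simp_all only: f gneg Reals_of_real Re_complex_of_real exp_gt_zero)
    show "\<omega> z = eta \<nu> z * g z" if z: "z \<in> slit" for z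
    proof -
      have "V z = Leta (V z) + of_real (1 / t) * L z"
        unfolding L_def using V(2)[OF z, symmetric] t by (simp add: field_simps)
      then show ?thesis
        by (simp only: \<omega>_def g_def eta\<nu>[OF z] eta\<omega>[OF z, unfolded \<omega>_def] exp_add[symmetric])
    qed
  qed
  have part4: "\<exists>h \<Phi>. is_power_branch (\<lambda>z. z / eta \<mu> z) (t - 1) h \<and>
      (\<forall>z\<in>slit. \<Phi> z = z * h z) \<and>
      \<Phi> holomorphic_on slit \<and> \<Phi> ` slit \<subseteq> - {0} \<and>
      (\<forall>z\<in>slit. \<Phi> (\<omega> z) = z)"
  proof (intro exI conjI ballI)
    \<comment> \<open>Again the imaginary parts pi cancel on the negative axis. At omega(z) the two
      logarithms are \<open>V z\<close> and \<open>Leta (V z)\<close>, so the equation for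
      \<open>V\<close> is the claim.\<close>
    define L where "L = (\<lambda>z. slog z - slog (eta \<mu> z))"
    define h where "h = (\<lambda>z. exp (of_real (t - 1) * L z))"
    define \<Phi> where "\<Phi> = (\<lambda>z. z * h z)"
    have "(slog \<circ> eta \<mu>) holomorphic_on slit"
      by (rule holomorphic_on_compose_gen[OF holomorphic_eta[OF nd] holomorphic_slog])
         (use eta_in_slit[OF nd] in auto)
    then have Lhol: "L holomorphic_on slit"
      unfolding L_def o_def by (intro holomorphic_intros holomorphic_slog)
    have f: "z / eta \<mu> z = exp (L z)" if "z \<in> slit" for z
      using that eta_in_slit[OF nd that] by (simp add: L_def exp_diff exp_slog)
    have Lneg: "L (of_real x) = of_real (ln (- x) - ln (- eta_real x))" if "x < 0" for x
      unfolding L_def eta_of_real[OF nd that] slog_neg[OF that] slog_neg[OF eta_real_neg[OF nd that]] by simp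
    have hneg: "h (of_real x) = of_real (exp ((t - 1) * (ln (- x) - ln (- eta_real x))))" if "x < 0" for x
      unfolding h_def Lneg[OF that] by (simp only: of_real_mult[symmetric] exp_of_real)
    show "is_power_branch (\<lambda>z. z / eta \<mu> z) (t - 1) h"
      unfolding is_power_branch_def
    proof (intro conjI exI[of _ L] ballI allI impI)
      show "h z = exp (of_real (t - 1) * L z)" for z by (simp only: h_def)
    qed (simp_all only: Lhol f hneg Reals_of_real Re_complex_of_real exp_gt_zero)
    show "\<Phi> z = z * h z" for z by (simp add: \<Phi>_def)
    show "\<Phi> holomorphic_on slit" unfolding \<Phi>_def h_def by (intro holomorphic_intros Lhol)
    show "\<Phi> ` slit \<subseteq> - {0}"
      by (rule image_subsetI) (auto simp: \<Phi>_def h_def)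
    show "\<Phi> (\<omega> z) = z" if z: "z \<in> slit" for z
    proof -
      have "L (\<omega> z) = V z - Leta (V z)"
        unfolding L_def \<omega>_def Leta_def slog_exp[OF V(1)[OF z]] ..
      then have "\<Phi> (\<omega> z) = exp (V z + of_real (t - 1) * (V z - Leta (V z)))"
        by (simp only: \<Phi>_def h_def \<omega>_def exp_add)
      also have "V z + of_real (t - 1) * (V z - Leta (V z)) = slog z"
        unfolding V(2)[OF z, symmetric] by (simp add: algebra_simps)
      finally show ?thesis using exp_slog[OF z] by simp
    qed
  qed
  have "prob_on_nonneg \<nu>" using \<nu>(1) by (simp add: prob_on_nonneg_iff)
  moreover have "\<omega> ` slit \<subseteq> slit" using \<omega>in by blast
  moreover have "\<forall>z. Im z > 0 \<longrightarrow> Arg z \<le> Arg (\<omega> z) \<and> Arg (\<omega> z) < pi"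
    using arg by blast
  moreover have "\<forall>z\<in>slit. eta \<nu> z = eta \<mu> (\<omega> z)" using eta\<nu> by blast
  ultimately show ?thesis
    by - (rule exI[where x = \<nu>], rule exI[where x = \<omega>],
          intro conjI nnd S \<omega>hol \<omega>axis \<omega>lim part3 part4)
qed

end
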